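(* Let $\beta$ be a Pisot number and let $T:[0,1]\to[0,1]$, $T(x)=\{\beta x\}$ (fractional part), equipped with its unique absolutely continuous invariant probability measure $\mu_\beta$. Let $[0,1]=\bigcup_{i=1}^{\ell} J_i$ be a finite partition of $[0,1]$ into subintervals, and let $S:[0,1]\to[0,1]$ be given by $$S(x)=\epsilon_i \beta^{m_i} x + b_i \quad\text{for } x\in J_i,$$ where $\epsilon_i\in\{-1,1\}$, $m_i$ is a positive integer and $b_i\in\mathbb{Q}(\beta)$ for $1\le i\le\ell$. Suppose that $S$ preserves a probability measure $\nu$ which is ergodic and absolutely continuous with respect to Lebesgue measure $\lambda$, and that there exists a constant $c>0$ with $$c^{-1}\lambda(E)\le \nu(E)\le c\,\lambda(E)$$ for every Borel set $E\subset[0,1]$. Then $T$ and $S$ are generic point equivalent, i.e., a point $x\in[0,1]$ is $T$-generic (with respect to $\mu_\beta$) if and only if it is $S$-generic (with respect to $\nu$).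
   Context: A Pisot number is a real algebraic integer greater than one all of whose Galois conjugates other than itself have modulus less than one (every integer greater than $1$ is one). The map $x\mapsto\{\beta x\}$ is ergodic with respect to a unique probability measure $\mu_\beta$ absolutely continuous with respect to Lebesgue measure (Parry's measure). The subintervals $J_i$ may be closed, open, half-open, or singletons. For a map $R:[0,1]\to[0,1]$ preserving a probability measure $\rho$, a point $x$ is called $R$-generic if $\lim_{N\to\infty}\frac1N\sum_{n=0}^{N-1} f(R^n x)=\int f\,d\rho$ for every continuous function $f$ on $[0,1]$. *)

theory Defs
  imports "HOL-Analysis.Analysis" "HOL-Probability.Probability"
    "HOL-Computational_Algebra.Polynomial"
begin

definition pisot :: "real \<Rightarrow> bool" where
  "pisot \<beta> \<longleftrightarrow> \<beta> > 1 \<and>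
     (\<exists>p :: int poly. lead_coeff p = 1 \<and> irreducible p \<and>
        poly (map_poly real_of_int p) \<beta> = 0 \<and>
        (\<forall>z :: complex. poly (map_poly complex_of_int p) z = 0 \<and> z \<noteq> complex_of_real \<beta>
            \<longrightarrow> cmod z < 1))"

definition Qext :: "real \<Rightarrow> real set" where
  "Qext \<beta> = {x. \<exists>p q :: rat poly. poly (map_poly real_of_rat q) \<beta> \<noteq> 0 \<and>
       x = poly (map_poly real_of_rat p) \<beta> / poly (map_poly real_of_rat q) \<beta>}"

definition lebesgue01 :: "real measure" where
  "lebesgue01 = restrict_space lborel {0..1}"

definition preserves :: "(real \<Rightarrow> real) \<Rightarrow> real measure \<Rightarrow> bool" where
  "preserves R \<rho> \<longleftrightarrow> R \<in> measurable \<rho> \<rho> \<and>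
     (\<forall>A \<in> sets \<rho>. emeasure \<rho> (R -` A \<inter> space \<rho>) = emeasure \<rho> A)"

definition ergodic_for :: "(real \<Rightarrow> real) \<Rightarrow> real measure \<Rightarrow> bool" where
  "ergodic_for R \<rho> \<longleftrightarrow> preserves R \<rho> \<and>
     (\<forall>A \<in> sets \<rho>. R -` A \<inter> space \<rho> = A \<longrightarrow> emeasure \<rho> A = 0 \<or> emeasure \<rho> A = 1)"

definition generic :: "(real \<Rightarrow> real) \<Rightarrow> real measure \<Rightarrow> real \<Rightarrow> bool" where
  "generic R \<rho> x \<longleftrightarrow>
     (\<forall>f :: real \<Rightarrow> real. continuous_on {0..1} f \<longrightarrow>
        (\<lambda>N. (\<Sum>n<N. f ((R ^^ n) x)) / real N) \<longlonglongrightarrow> integral\<^sup>L \<rho> f)"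

end

theory Submission
  imports Defs "HOL-Computational_Algebra.Polynomial_Factorial"
    "HOL-Computational_Algebra.Fundamental_Theorem_Algebra"
begin

text \<open>
  Both \<open>S\<^sup>n x\<close> and \<open>T\<^sup>k x\<close> have the form \<open>\<plusminus>\<beta>\<^sup>j x + a\<close>, where \<open>a\<close> lies in \<open>\<int>[\<beta>]\<close> up to a fixed
  denominator and, as the conjugates of \<open>\<beta>\<close> are contracting, has bounded conjugates.  Hence
  \<open>S\<^sup>n x\<close> and \<open>T\<^sup>k x\<close> with \<open>k\<close> close to the accumulated exponent \<open>m\<close> differ by one of finitely many
  affine maps.  So if \<open>x\<close> is generic for one of the two maps, every weak limit of the empirical
  measures of its orbit under the other one is dominated by finitely many affine images of an
  absolutely continuous measure, hence absolutely continuous, hence invariant (the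
  discontinuities are null).  Both maps are ergodic with respect to the Lebesgue measure class,
  so the absolutely continuous invariant probability measure is unique and is the only possible
  weak limit.
\<close>

text \<open>Why Lebesgue measure is the reference: a weak limit is only known to vanish on Lebesgue
  null sets, so uniqueness needs every invariant set to be null or conull for Lebesgue measure
  itself. For \<open>S\<close> this comes from the lower bound of \<nu> by Lebesgue measure;
  ergodicity of \<nu> alone would say nothing about sets that \<nu> does not see. For
  \<open>T\<close> it has to be proved, as \<mu> is only given as invariant: an invariant set
  repeats itself at scale 1/\<beta> in every full branch, so unless it is null it fills a fixed
  proportion of every interval. Why the exponents must be positive: each step of \<open>S\<close>
  then contributes at least one factor \<beta>, hence a contraction at every other conjugate. The
  two clocks differ: one step of \<open>S\<close> corresponds to a block of boundedly many steps of
  \<open>T\<close>. Comparing \<open>S\<close> with \<open>T\<close> therefore needs slopes 1 and -1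
  only, whereas comparing \<open>T\<close> with \<open>S\<close> also needs powers of \<beta> for
  the position inside a block.\<close>

section \<open>Integer polynomials at the conjugates of a Pisot number\<close>

text \<open>\<open>int poly\<close> is not a principal ideal ring, so the ideal generated by
  \<open>p\<close> and \<open>r\<close> is only guaranteed a nonzero integer, not 1. A nonzero
  member \<open>g\<close> of least degree divides integer multiples of both generators, and
  primality of \<open>p\<close> then forces \<open>g\<close> to be constant.\<close>

lemma irreducible_int_poly_bezout:
  fixes p r :: "int poly"
  assumes irr: "irreducible p" and deg: "degree p > 0" and ndvd: "\<not> p dvd r"
  obtains u v :: "int poly" and N :: int where "N \<noteq> 0" "u * p + v * r = [:N:]"
proof -
  define I where "I = {u * p + v * r | u v. True}"
  have I_lin: "x * a + y * b \<in> I" if ab: "a \<in> I" "b \<in> I" for a b x y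
  proof -
    obtain u v u' v' where "a = u * p + v * r" "b = u' * p + v' * r"
      using ab by (auto simp: I_def)
    then have "x * a + y * b = (x * u + y * u') * p + (x * v + y * v') * r"
      by (simp add: algebra_simps)
    then show ?thesis by (auto simp: I_def)
  qed
  have pI: "p \<in> I" unfolding I_def by (rule CollectI, rule exI[of _ 1], rule exI[of _ 0]) simp
  have rI: "r \<in> I" unfolding I_def by (rule CollectI, rule exI[of _ 0], rule exI[of _ 1]) simp
  have "\<exists>g. g \<in> I \<and> g \<noteq> 0" using pI deg by (intro exI[of _ p]) auto
  then obtain g where g: "g \<in> I" "g \<noteq> 0" and min: "\<And>h. h \<in> I \<Longrightarrow> h \<noteq> 0 \<Longrightarrow> degree g \<le> degree h"
    using ex_has_least_nat[of "\<lambda>g. g \<in> I \<and> g \<noteq> 0" _ degree] by blast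
  \<comment> \<open>Pseudo-division scales \<open>f\<close> by a power of the leading coefficient of
    \<open>g\<close>, so the remainder stays integral and inside \<open>I\<close>; minimality of the
    degree makes it vanish.\<close>
  have dv: "\<exists>c. c \<noteq> 0 \<and> g dvd smult c f" if f: "f \<in> I" for f
  proof -
    obtain k s where ks: "pseudo_divmod f g = (k, s)" by force
    define c where "c = lead_coeff g ^ (Suc (degree f) - degree g)"
    have eq: "smult c f = g * k + s" and s: "s = 0 \<or> degree s < degree g"
      using pseudo_divmod[OF g(2) ks] by (auto simp: c_def)
    have "s = [:c:] * f + (- k) * g" using eq by (simp add: algebra_simps)
    then have "s \<in> I" using I_lin[OF f g(1)] by metis
    then have "s = 0" using min s by (meson leD)
    then show ?thesis using eq g(2) by (intro exI[of _ c]) (auto simp: c_def)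
  qed
  have prime: "prime_elem p" using irreducible_imp_prime_poly[OF irr] .
  obtain c k where c: "c \<noteq> 0" "smult c p = g * k" using dv[OF pI] by (auto elim!: dvdE)
  obtain c' where c': "c' \<noteq> 0" "g dvd smult c' r" using dv[OF rI] by auto
  have "\<not> p dvd g"
  proof
    assume "p dvd g"
    then have "p dvd [:c':] * r" using c'(2) dvd_trans by auto
    then have "p dvd [:c':]" using prime ndvd by (metis prime_elem_dvd_mult_iff)
    then show False using deg c'(1) dvd_imp_degree_le[of p "[:c':]"] by auto
  qed
  moreover have "p dvd g * k" using c(2) by (metis dvd_smult dvd_refl)
  ultimately have "p dvd k" using prime by (metis prime_elem_dvd_mult_iff)
  then obtain k' where "k = p * k'" by (auto elim: dvdE)
  \<comment> \<open>Cancelling \<open>p\<close> exhibits \<open>g\<close> as a divisor of the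
    constant \<open>c\<close>.\<close>
  then have "p * [:c:] = p * (g * k')" using c(2) by (simp add: algebra_simps)
  then have gk: "[:c:] = g * k'" using deg by (metis mult_left_cancel degree_0 less_irrefl)
  then have "k' \<noteq> 0" using c(1) by auto
  then have "degree g = 0" using gk g(2) by (metis degree_mult_eq degree_pCons_0 add_is_0)
  then obtain N where "g = [:N:]" by (meson degree_eq_zeroE)
  then show ?thesis using that g by (auto simp: I_def)
qed

text \<open>An element of Z[\<beta>] is represented by an integer polynomial. Evaluation in an
  arbitrary ring lets one polynomial give both the real value at \<beta> and the complex conjugates,
  without field embeddings.\<close>

definition ipoly :: "int poly \<Rightarrow> 'a::{comm_ring_1,ring_char_0} \<Rightarrow> 'a" where
  "ipoly p x = poly (map_poly of_int p) x"

lemma ipoly_pCons: "ipoly (pCons c p) x = of_int c + x * ipoly p x"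
  by (simp add: ipoly_def map_poly_pCons)

lemma ipoly_0 [simp]: "ipoly 0 x = 0" and ipoly_const: "ipoly [:c:] x = of_int c"
  by (simp_all add: ipoly_def map_poly_pCons)

lemma ipoly_add: "ipoly (p + q) x = ipoly p x + ipoly q x"
proof -
  have "map_poly of_int (p + q) = map_poly of_int p + (map_poly of_int q :: 'a poly)"
    by (intro poly_eqI) (simp add: coeff_map_poly)
  then show ?thesis by (simp add: ipoly_def)
qed

lemma ipoly_smult: "ipoly (smult c p) x = of_int c * ipoly p x"
  by (simp add: ipoly_def map_poly_smult)

lemma ipoly_mult: "ipoly (p * q) x = ipoly p x * ipoly q x"
  by (induction p) (simp_all add: ipoly_add ipoly_smult ipoly_pCons algebra_simps)

lemma ipoly_monom: "ipoly (monom c n) x = of_int c * x ^ n"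
  by (simp add: ipoly_def map_poly_monom poly_monom)

lemma ipoly_of_real: "ipoly p (complex_of_real x) = complex_of_real (ipoly p x)"
  by (induction p) (simp_all add: ipoly_pCons)

lemma monic_root_degree_pos:
  assumes "lead_coeff p = 1" "ipoly p x = 0"
  shows "degree p > 0"
proof (rule ccontr)
  assume "\<not> degree p > 0"
  then obtain c where "p = [:c:]" by (auto elim: degree_eq_zeroE)
  then show False using assms by (auto simp: ipoly_const)
qed

text \<open>The derivative has smaller degree, so \<open>p\<close> does not divide it. At a common
  root the Bezout identity would make a nonzero integer vanish.\<close>

lemma irreducible_int_poly_separable:
  fixes p :: "int poly" and \<alpha> :: "'a::field_char_0"
  assumes irr: "irreducible p" and deg: "degree p > 0" and root: "ipoly p \<alpha> = 0"
  shows "poly (pderiv (map_poly of_int p)) \<alpha> \<noteq> 0"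
proof
  assume *: "poly (pderiv (map_poly of_int p)) \<alpha> = 0"
  have "map_poly of_int (pderiv p) = (pderiv (map_poly of_int p) :: 'a poly)"
    by (intro poly_eqI) (simp add: coeff_map_poly coeff_pderiv)
  then have d0: "ipoly (pderiv p) \<alpha> = 0" using * by (simp add: ipoly_def)
  have "pderiv p \<noteq> 0" using deg by (simp add: pderiv_eq_0_iff)
  then have "\<not> p dvd pderiv p"
    using deg dvd_imp_degree_le[of p "pderiv p"] by (auto simp: degree_pderiv)
  then obtain u v N where N: "N \<noteq> 0" "u * p + v * pderiv p = [:N:]"
    using irreducible_int_poly_bezout[OF irr deg] by metis
  have "of_int N = ipoly (u * p + v * pderiv p) \<alpha>" unfolding N(2) by (simp add: ipoly_const)
  then show False using N(1) root d0 by (simp add: ipoly_add ipoly_mult)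
qed

text \<open>Lagrange interpolation: a polynomial of degree below \<open>card A\<close> is the sum of
  the basis polynomials \<open>l \<alpha>\<close> weighted by its values. So \<open>K\<close> can be
  the sum of the moduli of all basis coefficients, which depends on \<open>A\<close> only.\<close>

lemma coeff_bounded_by_values:
  fixes A :: "complex set"
  assumes fin: "finite A"
  obtains K where "\<And>P B i. degree P < card A \<Longrightarrow> (\<And>\<alpha>. \<alpha> \<in> A \<Longrightarrow> cmod (poly P \<alpha>) \<le> B)
    \<Longrightarrow> i < card A \<Longrightarrow> cmod (coeff P i) \<le> B * K"
proof -
  define l where "l \<alpha> = (\<Prod>\<gamma>\<in>A - {\<alpha>}. smult (1 / (\<alpha> - \<gamma>)) [:- \<gamma>, 1:])" for \<alpha>
  have l_val: "poly (l \<alpha>) \<gamma> = (if \<gamma> = \<alpha> then 1 else 0)" if "\<alpha> \<in> A" "\<gamma> \<in> A" for \<alpha> \<gamma>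
  proof (cases "\<gamma> = \<alpha>")
    case True
    have "poly (smult (1 / (\<alpha> - \<delta>)) [:- \<delta>, 1:]) \<alpha> = 1" if "\<delta> \<in> A - {\<alpha>}" for \<delta>
      using that by (auto simp: divide_simps)
    then show ?thesis using True by (simp add: l_def poly_prod prod.neutral)
  qed (use that fin in \<open>auto simp: l_def poly_prod\<close>)
  have l_deg: "degree (l \<alpha>) < card A" if "\<alpha> \<in> A" for \<alpha>
  proof -
    have "degree (l \<alpha>) \<le> sum (degree \<circ> (\<lambda>\<gamma>. smult (1 / (\<alpha> - \<gamma>)) [:- \<gamma>, 1:])) (A - {\<alpha>})"
      unfolding l_def using fin by (intro degree_prod_sum_le) auto
    also have "\<dots> \<le> (\<Sum>\<gamma>\<in>A - {\<alpha>}. 1)" by (intro sum_mono) auto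
    also have "\<dots> < card A" using that card_Diff1_less[OF fin that] by simp
    finally show ?thesis .
  qed
  define K where "K = (\<Sum>i<card A. \<Sum>\<alpha>\<in>A. cmod (coeff (l \<alpha>) i))"
  show ?thesis
  proof (rule that[of K])
    fix P :: "complex poly" and B i
    assume P: "degree P < card A" "\<And>\<alpha>. \<alpha> \<in> A \<Longrightarrow> cmod (poly P \<alpha>) \<le> B" and i: "i < card A"
    have "A \<noteq> {}" using P(1) by auto
    then have B: "B \<ge> 0" using P(2) norm_ge_zero order_trans by (metis all_not_in_conv)
    have "P = (\<Sum>\<alpha>\<in>A. smult (poly P \<alpha>) (l \<alpha>))"
    proof (rule poly_eqI_degree[of A])
      fix x assume x: "x \<in> A"
      have "poly (\<Sum>\<alpha>\<in>A. smult (poly P \<alpha>) (l \<alpha>)) x = (\<Sum>\<alpha>\<in>A. if \<alpha> = x then poly P x else 0)"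
        using x by (auto simp: poly_sum l_val intro!: sum.cong)
      then show "poly P x = poly (\<Sum>\<alpha>\<in>A. smult (poly P \<alpha>) (l \<alpha>)) x"
        using x fin by simp
    next
      show "degree (\<Sum>\<alpha>\<in>A. smult (poly P \<alpha>) (l \<alpha>)) < card A"
        using l_deg P(1) by (intro degree_sum_less) (auto intro: le_less_trans[OF degree_smult_le])
    qed (use P in auto)
    then have "cmod (coeff P i) = cmod (\<Sum>\<alpha>\<in>A. poly P \<alpha> * coeff (l \<alpha>) i)"
      by (metis (no_types, lifting) coeff_smult coeff_sum sum.cong)
    also have "\<dots> \<le> (\<Sum>\<alpha>\<in>A. B * cmod (coeff (l \<alpha>) i))"
      using P(2) by (intro sum_norm_le) (auto simp: norm_mult intro!: mult_right_mono)
    also have "\<dots> \<le> B * K"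
      unfolding K_def sum_distrib_left[symmetric] using i B
      by (intro mult_left_mono member_le_sum) (auto intro: sum_nonneg)
    finally show "cmod (coeff P i) \<le> B * K" .
  qed
qed

lemma finite_int_polys_bounded_coeffs: "finite {P :: int poly. degree P < d \<and> (\<forall>i<d. \<bar>coeff P i\<bar> \<le> C)}"
proof (rule finite_subset)
  show "{P :: int poly. degree P < d \<and> (\<forall>i<d. \<bar>coeff P i\<bar> \<le> C)} \<subseteq>
      Poly ` {xs. set xs \<subseteq> {-C..C} \<and> length xs \<le> d}"
  proof
    fix P :: "int poly" assume P: "P \<in> {P. degree P < d \<and> (\<forall>i<d. \<bar>coeff P i\<bar> \<le> C)}"
    have "set (coeffs P) \<subseteq> {-C..C}"
    proof
      fix c assume "c \<in> set (coeffs P)"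
      then have "P \<noteq> 0" by auto
      with \<open>c \<in> set (coeffs P)\<close> obtain i where "i \<le> degree P" "c = coeff P i"
        by (auto simp: coeffs_def less_Suc_eq_le simp del: upt_Suc)
      then have "\<bar>c\<bar> \<le> C" using P by auto
      then show "c \<in> {-C..C}" by auto
    qed
    moreover have "length (coeffs P) \<le> d" using P length_coeffs_degree[of P] by (cases "P = 0") auto
    ultimately show "P \<in> Poly ` {xs. set xs \<subseteq> {-C..C} \<and> length xs \<le> d}"
      by (intro image_eqI[of _ _ "coeffs P"]) auto
  qed
  show "finite (Poly ` {xs. set xs \<subseteq> {-C..C::int} \<and> length xs \<le> d})"
    by (intro finite_imageI finite_lists_length_le) auto
qed

text \<open>Modulo \<open>p\<close> every \<open>Q\<close> has an integral remainder of degree below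
  \<open>degree p\<close> with the same values at all roots. By separability there are
  \<open>degree p\<close> roots, so interpolation turns a bound on these values into one on the
  coefficients, and bounded integers leave finitely many remainders.\<close>

lemma finite_values_bounded_conjugates:
  fixes p :: "int poly" and \<beta> :: real
  assumes monic: "lead_coeff p = 1" and irr: "irreducible p" and root: "ipoly p \<beta> = 0"
  shows "finite {ipoly Q \<beta> | Q. \<forall>\<alpha>::complex. ipoly p \<alpha> = 0 \<longrightarrow> cmod (ipoly Q \<alpha>) \<le> B}"
proof -
  define A where "A = {\<alpha>::complex. ipoly p \<alpha> = 0}"
  have p0: "p \<noteq> 0" using monic by auto
  have deg: "degree p > 0" using monic root by (rule monic_root_degree_pos)
  define pc where "pc = (map_poly of_int p :: complex poly)"
  have A_pc: "A = {\<alpha>. poly pc \<alpha> = 0}" by (simp add: A_def pc_def ipoly_def)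
  have deg_pc: "degree pc = degree p" unfolding pc_def by (rule degree_map_poly) simp
  then have pc0: "pc \<noteq> 0" using deg by auto
  have fin: "finite A" unfolding A_pc using pc0 by (rule poly_roots_finite)
  have "rsquarefree pc"
    unfolding rsquarefree_roots using irreducible_int_poly_separable[OF irr deg]
    by (auto simp: pc_def ipoly_def)
  then have card: "card A = degree p"
  proof -
    have "degree pc = degree (smult (lead_coeff pc) (\<Prod>z\<in>A. [:- z, 1:]))"
      using complex_poly_decompose_rsquarefree[OF \<open>rsquarefree pc\<close>] by (simp add: A_pc)
    also have "\<dots> = card A" using pc0 by (simp add: degree_prod_eq_sum_degree)
    finally show ?thesis using deg_pc by simp
  qed
  obtain K where K: "\<And>P B i. degree P < card A \<Longrightarrow> (\<And>\<alpha>. \<alpha> \<in> A \<Longrightarrow> cmod (poly P \<alpha>) \<le> B)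
    \<Longrightarrow> i < card A \<Longrightarrow> cmod (coeff P i) \<le> B * K"
    using coeff_bounded_by_values[OF fin] by blast
  define F where "F = {P :: int poly. degree P < degree p \<and> (\<forall>i<degree p. \<bar>coeff P i\<bar> \<le> \<lceil>B * K\<rceil>)}"
  have "{ipoly Q \<beta> | Q. \<forall>\<alpha>::complex. ipoly p \<alpha> = 0 \<longrightarrow> cmod (ipoly Q \<alpha>) \<le> B} \<subseteq> (\<lambda>P. ipoly P \<beta>) ` F"
  proof safe
    fix Q :: "int poly" assume Q: "\<forall>\<alpha>::complex. ipoly p \<alpha> = 0 \<longrightarrow> cmod (ipoly Q \<alpha>) \<le> B"
    \<comment> \<open>As \<open>p\<close> is monic, the scaling factor is 1 and this is exact
      division with remainder.\<close>
    obtain k s where ks: "pseudo_divmod Q p = (k, s)" by force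
    have eq: "Q = p * k + s" and s: "degree s < degree p"
      using pseudo_divmod[OF p0 ks] monic deg by auto
    have "cmod (coeff (map_poly of_int s) i) \<le> B * K" if "i < degree p" for i
    proof (rule K)
      show "degree (map_poly of_int s :: complex poly) < card A"
        using s card by (simp add: degree_map_poly)
      show "cmod (poly (map_poly of_int s) \<alpha>) \<le> B" if "\<alpha> \<in> A" for \<alpha>
        using Q that by (simp add: A_def eq ipoly_add ipoly_mult) (simp add: ipoly_def)
    qed (use that card in auto)
    then have "\<bar>real_of_int (coeff s i)\<bar> \<le> B * K" if "i < degree p" for i
      using that by (auto simp: coeff_map_poly)
    then have "\<bar>coeff s i\<bar> \<le> \<lceil>B * K\<rceil>" if "i < degree p" for i
      using that by (metis le_of_int_ceiling of_int_abs of_int_le_iff order_trans)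
    then have "s \<in> F" using s by (simp add: F_def)
    moreover have "ipoly Q \<beta> = ipoly s \<beta>" using root by (simp add: eq ipoly_add ipoly_mult)
    ultimately show "ipoly Q \<beta> \<in> (\<lambda>P. ipoly P \<beta>) ` F" by auto
  qed
  then show ?thesis using finite_int_polys_bounded_coeffs finite_subset unfolding F_def by blast
qed

section \<open>Denominators of elements of the field generated by \<beta>\<close>

lemma rat_poly_clear_denominators:
  fixes f :: "rat poly"
  obtains N :: int and g :: "int poly" where "N > 0"
    "\<And>x::real. of_int N * poly (map_poly real_of_rat f) x = ipoly g x"
proof -
  have "\<exists>N g. N > 0 \<and> (\<forall>x::real. of_int N * poly (map_poly real_of_rat f) x = ipoly g x)"
  proof (induction f)
    case 0
    show ?case by (rule exI[of _ 1], rule exI[of _ 0]) simp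
  next
    case (pCons a f)
    then obtain N g where N: "N > 0" and g: "\<And>x::real. of_int N * poly (map_poly real_of_rat f) x = ipoly g x"
      by auto
    obtain n d where nd: "quotient_of a = (n, d)" by force
    then have d: "d > 0" and a: "a = of_int n / of_int d"
      using quotient_of_denom_pos quotient_of_div by auto
    have ra: "real_of_int d * of_rat a = of_int n" using d by (simp add: a of_rat_divide)
    have "of_int (N * d) * poly (map_poly real_of_rat (pCons a f)) x = ipoly (pCons (N * n) (smult d g)) x" for x :: real
      using ra[symmetric] by (simp add: map_poly_pCons ipoly_pCons ipoly_smult g[symmetric] algebra_simps)
    then show ?case using N d by (intro exI[of _ "N * d"] exI[of _ "pCons (N * n) (smult d g)"]) auto
  qed
  then show ?thesis using that by blast
qed


text \<open>The denominator does not vanish at \<beta>, so \<open>p\<close> does not divide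
  \<open>h'\<close>. Evaluated at \<beta>, the Bezout identity says that \<open>v\<close> inverts
  \<open>h'\<close> up to the integer \<open>N\<close>.\<close>

lemma int_mult_Qext:
  fixes p :: "int poly" and \<beta> :: real
  assumes irr: "irreducible p" and deg: "degree p > 0" and root: "ipoly p \<beta> = 0" and y: "y \<in> Qext \<beta>"
  shows "\<exists>N>0. \<exists>Q. of_int N * y = ipoly Q \<beta>"
proof -
  obtain f h where h0: "poly (map_poly real_of_rat h) \<beta> \<noteq> 0"
    and y_eq: "y = poly (map_poly real_of_rat f) \<beta> / poly (map_poly real_of_rat h) \<beta>"
    using y by (auto simp: Qext_def)
  obtain N1 f' where f': "N1 > 0" "of_int N1 * poly (map_poly real_of_rat f) \<beta> = ipoly f' \<beta>"
    using rat_poly_clear_denominators[of f] by metis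
  obtain N2 h' where h': "N2 > 0" "of_int N2 * poly (map_poly real_of_rat h) \<beta> = ipoly h' \<beta>"
    using rat_poly_clear_denominators[of h] by metis
  have h'0: "ipoly h' \<beta> \<noteq> 0" using h' h0 by (metis mult_eq_0_iff of_int_0_eq_iff less_irrefl)
  then have "\<not> p dvd h'" using root by (auto simp: ipoly_mult elim!: dvdE)
  then obtain u v N where N: "N \<noteq> 0" "u * p + v * h' = [:N:]"
    using irreducible_int_poly_bezout[OF irr deg] by metis
  have "ipoly (u * p + v * h') \<beta> = of_int N" unfolding N(2) by (simp add: ipoly_const)
  then have vh: "ipoly v \<beta> * ipoly h' \<beta> = of_int N" using root by (simp add: ipoly_add ipoly_mult)
  have "of_int N1 * y * ipoly h' \<beta> = of_int N2 * ipoly f' \<beta>"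
    using f'(2)[symmetric] h'(2)[symmetric] h0 by (simp add: y_eq)
  then have "of_int N1 * y * (ipoly v \<beta> * ipoly h' \<beta>) = of_int N2 * ipoly f' \<beta> * ipoly v \<beta>"
    by (metis mult.assoc mult.commute)
  then have *: "of_int (N1 * N) * y = ipoly (smult N2 (f' * v)) \<beta>"
    unfolding vh by (simp add: ipoly_smult ipoly_mult mult_ac)
  \<comment> \<open>\<open>N\<close> may be negative; its sign is moved into the polynomial to keep
    the denominator positive.\<close>
  have "of_int (N1 * \<bar>N\<bar>) * y = ipoly (smult (sgn N) (smult N2 (f' * v))) \<beta>"
    unfolding ipoly_smult[of "sgn N"] *[symmetric] by (simp add: abs_sgn mult_ac)
  then show ?thesis using f'(1) N(1) by (intro exI[of _ "N1 * \<bar>N\<bar>"]) (auto simp: zero_less_mult_iff)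
qed

text \<open>Collects what the orbit comparison uses about Pisot numbers besides \<beta> > 1.
  \<open>A\<close> consists of the conjugates other than \<beta> and is empty for an integer. The
  size at \<beta> is bounded separately in the finiteness clause, since there the bound will come
  from the orbits and not from a contraction.\<close>

lemma pisot_conjugates:
  assumes "pisot \<beta>"
  obtains A :: "complex set" where "finite A" "\<And>\<alpha>. \<alpha> \<in> A \<Longrightarrow> cmod \<alpha> < 1"
    "\<And>B. finite {ipoly Q \<beta> | Q. \<bar>ipoly Q \<beta>\<bar> \<le> B \<and> (\<forall>\<alpha>\<in>A. cmod (ipoly Q \<alpha>) \<le> B)}"
    "\<And>y. y \<in> Qext \<beta> \<Longrightarrow> \<exists>N>0. \<exists>Q. of_int N * y = ipoly Q \<beta>"
proof -
  obtain p :: "int poly" where monic: "lead_coeff p = 1" and irr: "irreducible p"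
    and root: "ipoly p \<beta> = 0"
    and small: "\<And>z::complex. ipoly p z = 0 \<Longrightarrow> z \<noteq> of_real \<beta> \<Longrightarrow> cmod z < 1"
    using assms unfolding pisot_def ipoly_def[symmetric] by blast
  have deg: "degree p > 0" using monic root by (rule monic_root_degree_pos)
  define A where "A = {\<alpha>::complex. ipoly p \<alpha> = 0} - {of_real \<beta>}"
  have "map_poly of_int p \<noteq> (0 :: complex poly)"
    using monic by (metis coeff_0 coeff_map_poly of_int_0 of_int_1 zero_neq_one)
  then have "finite A" unfolding A_def ipoly_def by (intro finite_Diff poly_roots_finite)
  moreover have "finite {ipoly Q \<beta> | Q. \<bar>ipoly Q \<beta>\<bar> \<le> B \<and> (\<forall>\<alpha>\<in>A. cmod (ipoly Q \<alpha>) \<le> B)}" for B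
  proof (rule finite_subset[OF _ finite_values_bounded_conjugates[OF monic irr root, of B]], safe)
    fix Q :: "int poly"
    assume "\<bar>ipoly Q \<beta>\<bar> \<le> B" "\<forall>\<alpha>\<in>A. cmod (ipoly Q \<alpha>) \<le> B"
    then have "cmod (ipoly Q \<alpha>) \<le> B" if "ipoly p \<alpha> = 0" for \<alpha>
      using that by (cases "\<alpha> = of_real \<beta>") (simp_all add: A_def ipoly_of_real)
    then show "\<exists>Q'. ipoly Q \<beta> = ipoly Q' \<beta> \<and> (\<forall>\<alpha>::complex. ipoly p \<alpha> = 0 \<longrightarrow> cmod (ipoly Q' \<alpha>) \<le> B)"
      by (intro exI[of _ Q]) simp
  qed
  ultimately show ?thesis
    using that[of A] small int_mult_Qext[OF irr deg root] by (auto simp: A_def)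
qed

text \<open>\<open>C / (1 - \<theta>)\<close> is the fixed point of the increasing map
  \<open>\<lambda>r. \<theta> * r + C\<close>, so values below it stay below it.\<close>

lemma affine_recursion_bounded:
  fixes r :: "nat \<Rightarrow> real"
  assumes "r 0 \<le> C / (1 - \<theta>)" "0 \<le> \<theta>" "\<theta> < 1" "\<And>n. r (Suc n) \<le> \<theta> * r n + C"
  shows "r n \<le> C / (1 - \<theta>)"
proof (induction n)
  case (Suc n)
  have "r (Suc n) \<le> \<theta> * (C / (1 - \<theta>)) + C"
    using assms(4)[of n] mult_left_mono[OF Suc assms(2)] by linarith
  also have "\<dots> = C / (1 - \<theta>)" using assms(3) by (simp add: field_simps)
  finally show ?case .
qed (use assms in simp)

lemma finite_uniform_bound:
  fixes f :: "'a \<Rightarrow> 'b \<Rightarrow> real"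
  assumes "finite A" "\<And>a. a \<in> A \<Longrightarrow> \<exists>B. \<forall>n. f a n \<le> B"
  shows "\<exists>B. \<forall>a\<in>A. \<forall>n. f a n \<le> B"
  using assms
proof (induction A rule: finite_induct)
  case (insert a A)
  then obtain B B' where "\<forall>a\<in>A. \<forall>n. f a n \<le> B" "\<forall>n. f a n \<le> B'" by (meson insertCI)
  then show ?case by (intro exI[of _ "max B B'"]) (auto simp: le_max_iff_disj)
qed auto

section \<open>Comparison of orbits\<close>

text \<open>The averages over \<open>u\<close> of a nonnegative function are then bounded by a constant times averages
  over finitely many affine images of \<open>v\<close>.\<close>

definition affinely_dominated :: "(nat \<Rightarrow> real) \<Rightarrow> (nat \<Rightarrow> real) \<Rightarrow> bool" where
  "affinely_dominated u v \<longleftrightarrow> (\<exists>\<Phi> g m. finite \<Phi> \<and> (\<forall>\<phi>\<in>\<Phi>. fst \<phi> \<noteq> 0) \<and> m > 0 \<and>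
     (\<forall>k. g k \<le> m * k) \<and> (\<forall>n. finite {k. g k = n} \<and> card {k. g k = n} \<le> m) \<and>
     (\<forall>k. \<exists>\<phi>\<in>\<Phi>. u k = fst \<phi> * v (g k) + snd \<phi>))"

lemma common_denominator:
  fixes \<beta> :: real
  assumes "finite Y" "\<And>y. y \<in> Y \<Longrightarrow> \<exists>N>0. \<exists>Q. of_int N * y = ipoly Q \<beta>"
  shows "\<exists>q>0. \<forall>y\<in>Y. \<exists>Q. of_int q * y = ipoly Q \<beta>"
  using assms
proof (induction Y rule: finite_induct)
  case (insert y Y)
  obtain q where q: "q > 0" "\<forall>y\<in>Y. \<exists>Q. of_int q * y = ipoly Q \<beta>" using insert by auto
  obtain N Q where N: "N > 0" "of_int N * y = ipoly Q \<beta>" using insert by blast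
  have "\<exists>Q. of_int (q * N) * y' = ipoly Q \<beta>" if y': "y' \<in> insert y Y" for y'
  proof (cases "y' = y")
    case True
    then have "of_int (q * N) * y' = ipoly (smult q Q) \<beta>" using N by (simp add: ipoly_smult mult_ac)
    then show ?thesis by blast
  next
    case False
    then obtain Q' where "of_int q * y' = ipoly Q' \<beta>" using q y' by auto
    then have "of_int (q * N) * y' = ipoly (smult N Q') \<beta>" by (simp add: ipoly_smult mult_ac)
    then show ?thesis by blast
  qed
  then show ?case using q N by (intro exI[of _ "q * N"]) auto
qed (auto intro: exI[of _ 1])

text \<open>Both orbits are affine in the common starting point: up to sign the slope is a power of
  \<beta>, and after clearing the denominator \<open>q\<close> the translation lies in Z[\<beta>].
  Matching the powers eliminates the starting point and leaves an element of Z[\<beta>]. It is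
  bounded because the orbits stay in the unit interval, its conjugates are bounded by contraction,
  and so it takes finitely many values.\<close>

lemma pisot_orbits_affinely_dominated:
  fixes s t b :: "nat \<Rightarrow> real" and e d :: "nat \<Rightarrow> int" and k :: "nat \<Rightarrow> nat"
  assumes pis: "pisot \<beta>"
    and start: "s 0 = t 0"
    and s01: "\<And>n. s n \<in> {0..1}" and t01: "\<And>n. t n \<in> {0..1}"
    and s_Suc: "\<And>n. s (Suc n) = of_int (e n) * \<beta> ^ k n * s n + b n"
    and e: "\<And>n. e n \<in> {-1, 1}" and k_pos: "\<And>n. k n > 0" and k_le: "\<And>n. k n \<le> m"
    and b: "finite (range b)" "range b \<subseteq> Qext \<beta>"
    and t_Suc: "\<And>n. t (Suc n) = \<beta> * t n - of_int (d n)"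
    and d: "\<And>n. d n \<ge> 0" "\<And>n. of_int (d n) \<le> \<beta>"
  shows "affinely_dominated s t" and "affinely_dominated t s"
proof -
  obtain A :: "complex set" where A: "finite A" "\<And>\<alpha>. \<alpha> \<in> A \<Longrightarrow> cmod \<alpha> < 1"
    and fin: "\<And>B. finite {ipoly Q \<beta> | Q. \<bar>ipoly Q \<beta>\<bar> \<le> B \<and> (\<forall>\<alpha>\<in>A. cmod (ipoly Q \<alpha>) \<le> B)}"
    and Qe: "\<And>y. y \<in> Qext \<beta> \<Longrightarrow> \<exists>N>0. \<exists>Q. of_int N * y = ipoly Q \<beta>"
    using pisot_conjugates[OF pis] by blast
  have \<beta>: "\<beta> > 1" using pis by (simp add: pisot_def)
  have m: "m > 0" using k_pos k_le by (metis gr0I less_le_trans not_less0)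
  have "\<exists>q>0. \<forall>y\<in>range b. \<exists>Q. of_int q * y = ipoly Q \<beta>"
    using Qe b(2) by (intro common_denominator[OF b(1)]) auto
  then obtain q where q: "q > 0" and "\<forall>y\<in>range b. \<exists>Q. of_int q * y = ipoly Q \<beta>" by blast
  then obtain P where P: "\<And>y. y \<in> range b \<Longrightarrow> of_int q * y = ipoly (P y) \<beta>" by metis
  \<comment> \<open>\<open>a n\<close> carries the translation part of \<open>q * s n\<close>, and
    \<open>z n\<close> is Horner's rule for the digits \<open>d\<close>. Keeping them as polynomials
    allows both recursions to be read at every conjugate.\<close>
  define a where "a = rec_nat 0 (\<lambda>n r. monom (e n) (k n) * r + P (b n))"
  define z where "z = rec_nat 0 (\<lambda>n r. pCons (d n) r)"
  have a_simps: "a 0 = 0" "\<And>n. a (Suc n) = monom (e n) (k n) * a n + P (b n)"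
    by (simp_all add: a_def)
  have z_simps: "z 0 = 0" "\<And>n. z (Suc n) = pCons (d n) (z n)"
    by (simp_all add: z_def)
  define h where "h n = (\<Prod>i<n. e i)" for n
  define M where "M n = (\<Sum>i<n. k i)" for n
  have h: "h n \<in> {-1, 1}" for n
  proof (induction n)
    case (Suc n)
    then show ?case using e[of n] by (auto simp: h_def)
  qed (simp add: h_def)
  have habs: "\<bar>real_of_int (h n)\<bar> = 1" "cmod (of_int (h n)) = 1" "real_of_int (h n) * real_of_int (h n) = 1"
    for n using h[of n] by auto
  have s_eq: "of_int q * s n = of_int q * (of_int (h n) * \<beta> ^ M n * s 0) + ipoly (a n) \<beta>" for n
  proof (induction n)
    case 0
    show ?case by (simp add: h_def M_def a_simps)
  next
    case (Suc n)
    have "of_int q * s (Suc n) = of_int (e n) * \<beta> ^ k n * (of_int q * s n) + of_int q * b n"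
      by (simp add: s_Suc algebra_simps)
    also have "\<dots> = of_int q * (of_int (h (Suc n)) * \<beta> ^ M (Suc n) * s 0) + ipoly (a (Suc n)) \<beta>"
      unfolding Suc using P[of "b n"]
      by (simp add: a_simps ipoly_add ipoly_mult ipoly_monom h_def M_def power_add algebra_simps)
    finally show ?case .
  qed
  have t_eq: "t n = \<beta> ^ n * s 0 - ipoly (z n) \<beta>" for n
  proof (induction n)
    case (Suc n)
    then show ?case unfolding t_Suc Suc z_simps ipoly_pCons by (simp add: algebra_simps)
  qed (simp add: start z_simps)
  \<comment> \<open>At a conjugate each step multiplies by a factor of modulus at most
    \<open>cmod \<alpha>\<close>, because \<open>k n\<close> is positive, and adds one of finitely
    many translations.\<close>
  have "\<exists>B. \<forall>\<alpha>\<in>A. \<forall>n. cmod (ipoly (a n) \<alpha>) \<le> B"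
  proof (rule finite_uniform_bound[OF A(1)])
    fix \<alpha> assume \<alpha>: "\<alpha> \<in> A"
    define C where "C = (\<Sum>y\<in>range b. cmod (ipoly (P y) \<alpha>))"
    have C: "C \<ge> 0" by (simp add: C_def sum_nonneg)
    have "cmod (ipoly (a n) \<alpha>) \<le> C / (1 - cmod \<alpha>)" for n
    proof (rule affine_recursion_bounded)
      fix n
      have "cmod (ipoly (a (Suc n)) \<alpha>) \<le> cmod (of_int (e n) * \<alpha> ^ k n * ipoly (a n) \<alpha>) + cmod (ipoly (P (b n)) \<alpha>)"
        by (simp add: a_simps ipoly_add ipoly_mult ipoly_monom norm_triangle_ineq)
      also have "cmod (of_int (e n) * \<alpha> ^ k n * ipoly (a n) \<alpha>) = cmod \<alpha> ^ k n * cmod (ipoly (a n) \<alpha>)"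
        using e[of n] by (auto simp: norm_mult norm_power)
      also have "\<dots> \<le> cmod \<alpha> * cmod (ipoly (a n) \<alpha>)"
        using power_decreasing[of 1 "k n" "cmod \<alpha>"] k_pos[of n] A(2)[OF \<alpha>]
        by (intro mult_right_mono) auto
      also have "cmod (ipoly (P (b n)) \<alpha>) \<le> C"
        unfolding C_def using b(1) by (intro member_le_sum) auto
      finally show "cmod (ipoly (a (Suc n)) \<alpha>) \<le> cmod \<alpha> * cmod (ipoly (a n) \<alpha>) + C" by simp
    qed (use A(2)[OF \<alpha>] C in \<open>auto simp: a_simps\<close>)
    then show "\<exists>B. \<forall>n. cmod (ipoly (a n) \<alpha>) \<le> B" by blast
  qed
  then obtain Ba where Ba: "\<And>\<alpha> n. \<alpha> \<in> A \<Longrightarrow> cmod (ipoly (a n) \<alpha>) \<le> Ba" by blast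
  have "\<exists>B. \<forall>\<alpha>\<in>A. \<forall>n. cmod (ipoly (z n) \<alpha>) \<le> B"
  proof (rule finite_uniform_bound[OF A(1)])
    fix \<alpha> assume \<alpha>: "\<alpha> \<in> A"
    have "cmod (ipoly (z n) \<alpha>) \<le> \<beta> / (1 - cmod \<alpha>)" for n
    proof (rule affine_recursion_bounded)
      fix n
      have "cmod (ipoly (z (Suc n)) \<alpha>) \<le> cmod (of_int (d n)) + cmod (\<alpha> * ipoly (z n) \<alpha>)"
        unfolding z_simps ipoly_pCons by (rule norm_triangle_ineq)
      also have "\<dots> \<le> cmod \<alpha> * cmod (ipoly (z n) \<alpha>) + \<beta>"
        using d[of n] by (simp add: norm_mult)
      finally show "cmod (ipoly (z (Suc n)) \<alpha>) \<le> cmod \<alpha> * cmod (ipoly (z n) \<alpha>) + \<beta>" .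
    qed (use A(2)[OF \<alpha>] \<beta> in \<open>auto simp: z_simps\<close>)
    then show "\<exists>B. \<forall>n. cmod (ipoly (z n) \<alpha>) \<le> B" by blast
  qed
  then obtain Bz where Bz: "\<And>\<alpha> n. \<alpha> \<in> A \<Longrightarrow> cmod (ipoly (z n) \<alpha>) \<le> Bz" by blast
  \<comment> \<open>The first entry bounds the real size; its \<open>\<beta> ^ m\<close> leaves room
    for comparing \<open>t\<close> with a rescaled \<open>s\<close>. The second bounds the
    conjugates.\<close>
  define B where "B = max (of_int q * (1 + \<beta> ^ m)) (Ba + of_int q * Bz)"
  define Z where "Z = {ipoly Q \<beta> | Q. \<bar>ipoly Q \<beta>\<bar> \<le> B \<and> (\<forall>\<alpha>\<in>A. cmod (ipoly Q \<alpha>) \<le> B)}"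
  have finZ: "finite Z" unfolding Z_def by (rule fin)
  have \<beta>m: "\<beta> ^ j \<le> \<beta> ^ m" if "j \<le> m" for j using \<beta> that by (intro power_increasing) auto
  have M_Suc: "M (Suc n) = M n + k n" for n by (simp add: M_def)
  have M_ge: "n \<le> M n" for n
    by (induction n) (use k_pos M_Suc in \<open>auto simp: M_def Suc_le_eq intro: le_less_trans\<close>)
  have M_mono: "strict_mono M" using k_pos by (auto simp: strict_mono_Suc_iff M_Suc)
  have M_le: "M n \<le> m * n" for n
    unfolding M_def using sum_bounded_above[of "{..<n}" k m] k_le by (simp add: mult.commute)
  have close: "of_int q * \<bar>u - v\<bar> \<le> B" if "\<bar>u\<bar> \<le> 1" "\<bar>v\<bar> \<le> \<beta> ^ m" for u v
  proof -
    have "of_int q * \<bar>u - v\<bar> \<le> of_int q * (1 + \<beta> ^ m)"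
      using that q by (intro mult_left_mono) auto
    then show ?thesis by (simp add: B_def)
  qed

  show "affinely_dominated s t"
    unfolding affinely_dominated_def
  proof (intro exI conjI allI ballI)
    \<comment> \<open>Step \<open>n\<close> of \<open>s\<close> is matched with step
      \<open>M n\<close> of \<open>t\<close>, where the slopes agree up to the sign
      \<open>h n\<close>. Strict monotonicity of \<open>M\<close> leaves at most one index per
      fibre.\<close>
    let ?\<Phi> = "{1, -1::real} \<times> (\<lambda>w. w / of_int q) ` Z"
    show "finite ?\<Phi>" using finZ by auto
    show "fst \<phi> \<noteq> 0" if "\<phi> \<in> ?\<Phi>" for \<phi> using that by auto
    show "m > 0" by (rule m)
    show "M n \<le> m * n" for n by (rule M_le)
    have sub: "{k. M k = n} \<subseteq> {inv M n}" for n
      using strict_mono_imp_inj_on[OF M_mono] by (auto simp: inv_f_f)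
    then show "finite {k. M k = n}" for n using finite_subset by blast
    show "card {k. M k = n} \<le> m" for n
      using card_mono[OF _ sub[of n]] m by simp
    fix n
    define w where "w = ipoly (a n + smult (q * h n) (z (M n))) \<beta>"
    have w: "w = of_int q * (s n - of_int (h n) * t (M n))"
      using s_eq[of n] by (simp add: w_def t_eq ipoly_add ipoly_smult algebra_simps)
    have "\<bar>of_int (h n) * t (M n)\<bar> \<le> 1" using t01[of "M n"] habs[of n] by (simp add: abs_mult)
    then have "\<bar>of_int (h n) * t (M n)\<bar> \<le> \<beta> ^ m" using \<beta>m[of 0] by simp
    then have "\<bar>w\<bar> \<le> B" using close[of "s n" "of_int (h n) * t (M n)"] s01[of n] q by (simp add: w abs_mult)
    moreover have "cmod (ipoly (a n + smult (q * h n) (z (M n))) \<alpha>) \<le> B" if "\<alpha> \<in> A" for \<alpha>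
    proof -
      have "cmod (ipoly (a n + smult (q * h n) (z (M n))) \<alpha>)
          \<le> cmod (ipoly (a n) \<alpha>) + cmod (of_int (q * h n) * ipoly (z (M n)) \<alpha>)"
        unfolding ipoly_add ipoly_smult by (rule norm_triangle_ineq)
      also have "\<dots> \<le> Ba + of_int q * Bz"
        using Ba[OF that, of n] Bz[OF that, of "M n"] q habs(2)[of n] by (simp add: norm_mult add_mono)
      finally show ?thesis by (simp add: B_def)
    qed
    ultimately have "w \<in> Z" by (auto simp: Z_def w_def)
    moreover have "s n = of_int (h n) * t (M n) + w / of_int q" using q by (simp add: w)
    ultimately show "\<exists>\<phi>\<in>?\<Phi>. s n = fst \<phi> * t (M n) + snd \<phi>"
      using h[of n] by (intro bexI[of _ "(of_int (h n), w / of_int q)"]) auto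
  qed

  \<comment> \<open>For the converse, time \<open>i\<close> of \<open>t\<close> is assigned to the
    block from \<open>M n\<close> to \<open>M (Suc n)\<close> that contains it. A block has length
    \<open>k n\<close>, at most \<open>m\<close>, which bounds the multiplicity.\<close>
  have "\<exists>n. M n \<le> i \<and> i < M (Suc n)" for i
  proof (induction i)
    case 0
    show ?case using k_pos[of 0] by (intro exI[of _ 0]) (simp add: M_def)
  next
    case (Suc i)
    then obtain n where n: "M n \<le> i" "i < M (Suc n)" by auto
    show ?case
    proof (cases "Suc i < M (Suc n)")
      case True
      then show ?thesis using n by (intro exI[of _ n]) auto
    next
      case False
      then have "Suc i = M (Suc n)" using n by auto
      then show ?thesis using k_pos[of "Suc n"] by (intro exI[of _ "Suc n"]) (simp add: M_Suc[of "Suc n"])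
    qed
  qed
  then obtain g where g: "\<And>i. M (g i) \<le> i" "\<And>i. i < M (Suc (g i))" by metis
  show "affinely_dominated t s"
    unfolding affinely_dominated_def
  proof (intro exI conjI allI ballI)
    \<comment> \<open>The offset \<open>j\<close> of \<open>i\<close> in its block has no
      counterpart in \<open>s\<close>, so slopes \<open>\<beta> ^ j\<close> occur.\<close>
    let ?\<Phi> = "(\<lambda>(\<sigma>, j). \<sigma> * \<beta> ^ j) ` ({1, -1::real} \<times> {..m}) \<times> (\<lambda>w. - w / of_int q) ` Z"
    show "finite ?\<Phi>" using finZ by auto
    show "fst \<phi> \<noteq> 0" if "\<phi> \<in> ?\<Phi>" for \<phi> using that \<beta> by auto
    show "m > 0" by (rule m)
    show "g i \<le> m * i" for i
      using M_ge[of "g i"] g(1)[of i] m by (metis le_trans mult_le_mono1 nat_mult_1 One_nat_def Suc_leI)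
    have sub: "{i. g i = n} \<subseteq> {M n..<M (Suc n)}" for n using g by auto
    then show "finite {i. g i = n}" for n using finite_subset by blast
    show "card {i. g i = n} \<le> m" for n
      using card_mono[OF _ sub[of n]] k_le[of n] by (simp add: M_Suc)
    fix i
    define n where "n = g i"
    define j where "j = i - M n"
    have i: "i = M n + j" and j: "j \<le> m" using g[of i] k_le[of n] by (auto simp: n_def j_def M_Suc)
    define w where "w = ipoly (smult (h n) (monom 1 j * a n) + smult q (z i)) \<beta>"
    have a_eq: "ipoly (a n) \<beta> = of_int q * s n - of_int q * (of_int (h n) * \<beta> ^ M n * s 0)"
      using s_eq[of n] by simp
    have "w = of_int (h n) * \<beta> ^ j * ipoly (a n) \<beta> + of_int q * ipoly (z i) \<beta>"
      by (simp add: w_def ipoly_add ipoly_smult ipoly_mult ipoly_monom)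
    \<comment> \<open>The square of the sign is 1, so the last term becomes
      \<open>\<beta> ^ i * s 0\<close>, which combines with \<open>z i\<close> to
      \<open>t i\<close>.\<close>
    then have "w = of_int q * (of_int (h n) * \<beta> ^ j * s n) + of_int q * ipoly (z i) \<beta>
        - of_int q * ((of_int (h n) * of_int (h n)) * \<beta> ^ i * s 0)"
      unfolding a_eq by (simp add: i power_add algebra_simps)
    then have w: "- w = of_int q * (t i - of_int (h n) * \<beta> ^ j * s n)"
      unfolding habs(3) t_eq by (simp add: algebra_simps)
    have "\<bar>of_int (h n) * \<beta> ^ j * s n\<bar> = \<beta> ^ j * s n"
      using s01[of n] habs(1)[of n] \<beta> by (simp add: abs_mult)
    also have "\<dots> \<le> \<beta> ^ j" using s01[of n] \<beta> by (simp add: mult_left_le)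
    also have "\<dots> \<le> \<beta> ^ m" by (rule \<beta>m[OF j])
    finally have "\<bar>- w\<bar> \<le> B"
      using close[of "t i" "of_int (h n) * \<beta> ^ j * s n"] t01[of i] q unfolding w by (simp add: abs_mult)
    moreover have "cmod (ipoly (smult (h n) (monom 1 j * a n) + smult q (z i)) \<alpha>) \<le> B" if "\<alpha> \<in> A" for \<alpha>
    proof -
      have "cmod (ipoly (smult (h n) (monom 1 j * a n) + smult q (z i)) \<alpha>)
          \<le> cmod (of_int (h n) * (\<alpha> ^ j * ipoly (a n) \<alpha>)) + cmod (of_int q * ipoly (z i) \<alpha>)"
        unfolding ipoly_add ipoly_smult ipoly_mult ipoly_monom by (metis norm_triangle_ineq mult_1 of_int_1)
      also have "cmod (of_int (h n) * (\<alpha> ^ j * ipoly (a n) \<alpha>)) = cmod \<alpha> ^ j * cmod (ipoly (a n) \<alpha>)"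
        using habs(2)[of n] by (simp add: norm_mult norm_power)
      also have "\<dots> \<le> 1 * Ba"
        using Ba[OF that, of n] A(2)[OF that] by (intro mult_mono) (auto intro: power_le_one)
      also have "cmod (of_int q * ipoly (z i) \<alpha>) \<le> of_int q * Bz"
        using Bz[OF that, of i] q by (simp add: norm_mult)
      finally show ?thesis by (simp add: B_def)
    qed
    ultimately have "w \<in> Z" by (auto simp: Z_def w_def)
    moreover have "t i = of_int (h n) * \<beta> ^ j * s n + - w / of_int q" using q by (simp add: w)
    ultimately show "\<exists>\<phi>\<in>?\<Phi>. t i = fst \<phi> * s (g i) + snd \<phi>"
      using h[of n] j by (intro bexI[of _ "(of_int (h n) * \<beta> ^ j, - w / of_int q)"])
        (force simp: n_def[symmetric])+
  qed
qed

section \<open>Ergodicity of the beta transformation\<close>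

lemma emeasure_affine_preimage:
  fixes a c :: real
  assumes "a \<noteq> 0" "E \<in> sets borel"
  shows "emeasure lborel E = ennreal \<bar>a\<bar> * emeasure lborel {x. a * x + c \<in> E}"
proof -
  have "emeasure lborel E = emeasure (density (distr lborel borel (\<lambda>x. c + a * x)) (\<lambda>_. ennreal \<bar>a\<bar>)) E"
    using lborel_real_affine[of a c] assms by simp
  also have "\<dots> = ennreal \<bar>a\<bar> * emeasure (distr lborel borel (\<lambda>x. c + a * x)) E"
    using assms by (subst emeasure_density_const) auto
  also have "emeasure (distr lborel borel (\<lambda>x. c + a * x)) E = emeasure lborel {x. a * x + c \<in> E}"
    using assms by (subst emeasure_distr) (auto intro!: arg_cong[where f="emeasure lborel"] simp: add.commute)
  finally show ?thesis .
qed

locale beta_invariant_set =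
  fixes \<beta> :: real and A :: "real set"
  assumes \<beta>: "\<beta> > 1" and A_borel: "A \<in> sets borel"
    and A_inv: "\<And>x. x \<in> {0..1} \<Longrightarrow> x \<in> A \<longleftrightarrow> frac (\<beta> * x) \<in> A"
begin

text \<open>Mass of \<open>A\<close> to the left of \<open>t\<close>. Invariance of \<open>A\<close>
  makes this function self-similar under the branches of the map, and that alone yields a linear
  lower bound on its increments.\<close>

definition G :: "real \<Rightarrow> real" where "G t = measure lborel (A \<inter> {0..<t})"

lemma G_fin: "emeasure lborel (A \<inter> {s..<t}) < \<infinity>"
proof -
  have "emeasure lborel (A \<inter> {s..<t}) \<le> emeasure lborel {s..<t}"
    using A_borel by (intro emeasure_mono) auto
  then show ?thesis by (cases "s \<le> t") (auto intro: le_less_trans)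
qed

lemma G_diff: "0 \<le> s \<Longrightarrow> s \<le> t \<Longrightarrow> G t - G s = measure lborel (A \<inter> {s..<t})"
proof -
  assume st: "0 \<le> s" "s \<le> t"
  have "A \<inter> {0..<t} = (A \<inter> {0..<s}) \<union> (A \<inter> {s..<t})" using st by auto
  moreover have "measure lborel ((A \<inter> {0..<s}) \<union> (A \<inter> {s..<t})) = measure lborel (A \<inter> {0..<s}) + measure lborel (A \<inter> {s..<t})"
    using A_borel G_fin by (intro measure_Union) (auto simp: less_top)
  ultimately show ?thesis by (simp add: G_def)
qed

lemma G_mono: "0 \<le> s \<Longrightarrow> s \<le> t \<Longrightarrow> G s \<le> G t"
  using G_diff[of s t] measure_nonneg[of lborel "A \<inter> {s..<t}"] by linarith

lemma G_0: "G 0 = 0" by (simp add: G_def)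

text \<open>On the branch starting at \<open>n / \<beta>\<close> the map is affine with slope
  \<beta>, so \<open>A\<close> there is a copy of \<open>A \<inter> {0..<r}\<close> shrunk by
  \<beta>. The bound on \<open>n + r\<close> keeps the piece inside the unit interval, where
  invariance is available.\<close>

lemma G_branch:
  fixes n :: nat
  assumes r: "0 \<le> r" "r \<le> 1" and n: "of_nat n + r \<le> \<beta>"
  shows "G ((of_nat n + r) / \<beta>) - G (of_nat n / \<beta>) = G r / \<beta>"
proof -
  have "G ((of_nat n + r) / \<beta>) - G (of_nat n / \<beta>) = measure lborel (A \<inter> {of_nat n / \<beta>..<(of_nat n + r) / \<beta>})"
    using r \<beta> by (intro G_diff) (auto simp: divide_right_mono)
  also have "A \<inter> {of_nat n / \<beta>..<(of_nat n + r) / \<beta>} = {x. \<beta> * x - of_nat n \<in> A \<inter> {0..<r}}"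
  proof (rule set_eqI)
    fix x
    show "x \<in> A \<inter> {of_nat n / \<beta>..<(of_nat n + r) / \<beta>} \<longleftrightarrow> x \<in> {x. \<beta> * x - of_nat n \<in> A \<inter> {0..<r}}"
    proof (cases "0 \<le> \<beta> * x - of_nat n \<and> \<beta> * x - of_nat n < r")
      case True
      have "\<beta> * x < \<beta> * 1" "\<beta> * x \<ge> 0" using True n by linarith+
      then have "x \<in> {0..1}" using \<beta> by (auto simp: zero_le_mult_iff mult_less_cancel_left_pos simp del: mult_1_right)
      moreover have "frac (\<beta> * x) = \<beta> * x - of_nat n"
        using True r by (subst frac_unique_iff) auto
      ultimately have "x \<in> A \<longleftrightarrow> \<beta> * x - of_nat n \<in> A" using A_inv[of x] by simp
      moreover have "x \<in> {of_nat n / \<beta>..<(of_nat n + r) / \<beta>}"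
        using True \<beta> by (auto simp: field_simps)
      ultimately show ?thesis using True by auto
    qed (use \<beta> in \<open>auto simp: field_simps\<close>)
  qed
  also have "measure lborel {x. \<beta> * x - of_nat n \<in> A \<inter> {0..<r}} = measure lborel (A \<inter> {0..<r}) / \<beta>"
    unfolding measure_def using \<beta> A_borel
    by (subst (2) emeasure_affine_preimage[of \<beta> _ "- of_nat n"]) (auto simp: enn2real_mult)
  finally show ?thesis by (simp add: G_def)
qed

lemma G_nat:
  "of_nat n \<le> \<beta> \<Longrightarrow> G (of_nat n / \<beta>) = of_nat n * G 1 / \<beta>"
proof (induction n)
  case (Suc n)
  then show ?case using G_branch[of 1 n] by (simp add: field_simps)
qed (simp add: G_0)

text \<open>Below \<open>t\<close> lie \<open>\<lfloor>\<beta> * t\<rfloor>\<close> full branches of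
  mass \<open>G 1 / \<beta>\<close> each and the initial piece of one more.\<close>

lemma G_rec:
  assumes t: "0 \<le> t" "t \<le> 1"
  shows "G t = (of_int \<lfloor>\<beta> * t\<rfloor> * G 1 + G (frac (\<beta> * t))) / \<beta>"
proof -
  define n where "n = nat \<lfloor>\<beta> * t\<rfloor>"
  have bt: "0 \<le> \<beta> * t" "\<beta> * t \<le> \<beta>" using t \<beta> by (auto simp: mult_left_le)
  have n: "of_int \<lfloor>\<beta> * t\<rfloor> = real n" using bt by (simp add: n_def)
  have eq: "\<beta> * t = real n + frac (\<beta> * t)" using n by (simp add: frac_def)
  then have t_eq: "t = (real n + frac (\<beta> * t)) / \<beta>" using \<beta> by (simp add: field_simps)
  have "real n \<le> \<beta>" using eq bt frac_ge_0[of "\<beta> * t"] by linarith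
  moreover have "G ((real n + frac (\<beta> * t)) / \<beta>) - G (real n / \<beta>) = G (frac (\<beta> * t)) / \<beta>"
    using eq bt by (intro G_branch) (auto simp: less_imp_le[OF frac_lt_1])
  ultimately show ?thesis using G_nat[of n] n t_eq by (simp add: add_divide_distrib)
qed

text \<open>An interval starting at 0 and inside the first branch is stretched by \<beta> while
  keeping its proportion of \<open>A\<close>. After finitely many steps it contains the whole first
  branch, whose mass is \<open>G 1 / \<beta>\<close>.\<close>

lemma G_lower_0:
  assumes r: "0 \<le> r" "r \<le> 1"
  shows "G r \<ge> G 1 / \<beta> * r"
proof (cases "r = 0")
  case False
  have G1: "G 1 \<ge> 0" by (simp add: G_def)
  have "\<exists>n. 1 \<le> \<beta> ^ n * r"
    using real_arch_pow[OF \<beta>, of "1 / r"] False r by (auto simp: field_simps intro: less_imp_le)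
  then obtain n where "1 \<le> \<beta> ^ n * r" by blast
  then show ?thesis using r False
  proof (induction n arbitrary: r)
    case 0
    then have "r = 1" by simp
    then show ?case using mult_right_mono[of 1 \<beta> "G 1"] G1 \<beta> by (simp add: field_simps)
  next
    case (Suc n)
    show ?case
    proof (cases "1 \<le> \<beta> * r")
      case True
      have "G (1 / \<beta>) \<le> G r" using True \<beta> by (intro G_mono) (auto simp: field_simps)
      moreover have "G (1 / \<beta>) = G 1 / \<beta>" using G_nat[of 1] \<beta> by simp
      moreover have "G 1 / \<beta> * r \<le> G 1 / \<beta> * 1" using G1 \<beta> Suc.prems by (intro mult_left_mono) auto
      ultimately show ?thesis by simp
    next
      case False
      then have fr: "\<lfloor>\<beta> * r\<rfloor> = 0" "frac (\<beta> * r) = \<beta> * r"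
        using Suc.prems \<beta> by (auto simp: floor_eq_iff frac_eq)
      have "G r = G (\<beta> * r) / \<beta>" using G_rec[of r] Suc.prems fr by simp
      moreover have "G 1 / \<beta> * (\<beta> * r) \<le> G (\<beta> * r)"
        using Suc.prems False \<beta> by (intro Suc.IH) (auto simp: algebra_simps)
      ultimately show ?thesis using \<beta> by (simp add: field_simps)
    qed
  qed
qed (simp add: G_0)

text \<open>The error of the lower bound shrinks by the factor \<open>\<beta>\<close> with each application of the map:
  an interval crossing a branch point splits into a part ending at 1, full branches, and a part
  starting at 0, and only the first carries an error.\<close>

lemma G_lower_approx:
  "0 \<le> s \<Longrightarrow> s \<le> t \<Longrightarrow> t \<le> 1 \<Longrightarrow> G t - G s \<ge> G 1 / \<beta> * (t - s) - G 1 / \<beta> ^ n"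
proof (induction n arbitrary: s t)
  case 0
  have "G 1 \<ge> 0" by (simp add: G_def)
  \<comment> \<open>For exponent 0 the error \<open>G 1\<close> already swallows the main
    term.\<close>
  have "G 1 / \<beta> * (t - s) \<le> G 1 * 1"
    using 0 \<beta> \<open>G 1 \<ge> 0\<close> mult_right_mono[of 1 \<beta> "G 1"] by (intro mult_mono) (auto simp: field_simps)
  then show ?case using G_mono[of s t] 0 by simp
next
  case (Suc n)
  have G1: "G 1 \<ge> 0" by (simp add: G_def)
  define fs where "fs = frac (\<beta> * s)"
  define ft where "ft = frac (\<beta> * t)"
  define i where "i = \<lfloor>\<beta> * s\<rfloor>"
  define j where "j = \<lfloor>\<beta> * t\<rfloor>"
  have fsft: "0 \<le> fs" "fs \<le> 1" "0 \<le> ft" "ft \<le> 1" by (auto simp: fs_def ft_def less_imp_le[OF frac_lt_1])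
  have bs: "\<beta> * s = of_int i + fs" and bt: "\<beta> * t = of_int j + ft"
    by (auto simp: fs_def ft_def i_def j_def frac_def)
  have "i \<le> j" unfolding i_def j_def using Suc.prems \<beta> by (intro floor_mono) auto
  have Gs: "\<beta> * G s = of_int i * G 1 + G fs" and Gt: "\<beta> * G t = of_int j * G 1 + G ft"
    using G_rec[of s] G_rec[of t] Suc.prems \<beta> by (auto simp: fs_def ft_def i_def j_def field_simps)
  have "\<beta> * (G t - G s) \<ge> G 1 / \<beta> * (\<beta> * t - \<beta> * s) - G 1 / \<beta> ^ n"
  proof (cases "i = j")
    case True
    then have "fs \<le> ft" using bs bt Suc.prems \<beta> by (metis add_le_cancel_left mult_left_mono less_imp_le order_trans zero_less_one)
    then have "G 1 / \<beta> * (ft - fs) - G 1 / \<beta> ^ n \<le> G ft - G fs" using Suc.IH[of fs ft] fsft by simp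
    then show ?thesis using True Gs Gt bs bt by (simp add: right_diff_distrib)
  next
    case False
    \<comment> \<open>\<open>j - i - 1\<close> counts the full branches strictly between those of
      \<open>s\<close> and \<open>t\<close>.\<close>
    then have ij: "real_of_int (j - i - 1) \<ge> 0" using \<open>i \<le> j\<close> by simp
    have 1: "G 1 / \<beta> * (1 - fs) - G 1 / \<beta> ^ n \<le> G 1 - G fs" using Suc.IH[of fs 1] fsft by simp
    have 2: "G 1 / \<beta> * ft \<le> G ft" using G_lower_0 fsft by simp
    have "G 1 / \<beta> \<le> G 1" using G1 \<beta> mult_right_mono[of 1 \<beta> "G 1"] by (simp add: field_simps)
    then have 3: "G 1 / \<beta> * real_of_int (j - i - 1) \<le> G 1 * real_of_int (j - i - 1)"
      using ij by (rule mult_right_mono)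
    have "\<beta> * (G t - G s) = G 1 * real_of_int (j - i - 1) + (G 1 - G fs) + G ft"
      by (simp add: right_diff_distrib Gs Gt algebra_simps)
    moreover have "G 1 / \<beta> * (\<beta> * t - \<beta> * s) = G 1 / \<beta> * real_of_int (j - i - 1) + G 1 / \<beta> * (1 - fs) + G 1 / \<beta> * ft"
      unfolding bs bt distrib_left[symmetric] by simp
    ultimately show ?thesis using 1 2 3 by linarith
  qed
  then have "(G 1 / \<beta> * (\<beta> * t - \<beta> * s) - G 1 / \<beta> ^ n) / \<beta> \<le> G t - G s"
    using \<beta> by (simp add: field_simps)
  moreover have "(G 1 / \<beta> * (\<beta> * t - \<beta> * s) - G 1 / \<beta> ^ n) / \<beta> = G 1 / \<beta> * (t - s) - G 1 / \<beta> ^ Suc n"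
    using \<beta> by (simp add: field_simps)
  ultimately show ?case by linarith
qed

lemma G_lower:
  assumes "0 \<le> s" "s \<le> t" "t \<le> 1"
  shows "G t - G s \<ge> G 1 / \<beta> * (t - s)"
proof (rule LIMSEQ_le_const2)
  have "(\<lambda>n. G 1 * (1 / \<beta>) ^ n) \<longlonglongrightarrow> G 1 * 0"
    using \<beta> by (intro tendsto_mult_left LIMSEQ_power_zero) auto
  then have "(\<lambda>n. G 1 / \<beta> * (t - s) - G 1 / \<beta> ^ n) \<longlonglongrightarrow> G 1 / \<beta> * (t - s) - 0"
    by (intro tendsto_diff) (auto simp: power_divide)
  then show "(\<lambda>n. G 1 / \<beta> * (t - s) - G 1 / \<beta> ^ n) \<longlonglongrightarrow> G 1 / \<beta> * (t - s)" by simp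
  show "\<exists>N. \<forall>n\<ge>N. G 1 / \<beta> * (t - s) - G 1 / \<beta> ^ n \<le> G t - G s"
    using G_lower_approx[OF assms] by auto
qed

end


section \<open>Sets whose complement is uniformly thick\<close>

lemma exists_compact_positive:
  fixes M :: "'a::{second_countable_topology, complete_space} measure"
  assumes "sets M = sets borel" "finite_measure M" "E \<in> sets borel" "emeasure M E > 0"
  obtains K where "K \<subseteq> E" "compact K" "emeasure M K > 0"
proof -
  have "emeasure M (space M) \<noteq> \<infinity>" using assms(2) by (simp add: finite_measure.emeasure_finite)
  then have "0 < (SUP K \<in> {K. K \<subseteq> E \<and> compact K}. emeasure M K)"
    using inner_regular[OF assms(1) _ assms(3)] assms(4) by simp
  then show ?thesis using that by (auto simp: less_SUP_iff)
qed

text \<open>A density argument on a grid. If the complement had positive measure, a compact part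
  \<open>K\<close> of it would have an open neighbourhood \<open>U\<close> with little excess. Grid
  cells meeting \<open>K\<close> lie in \<open>U\<close>, and \<open>A\<close> takes the proportion
  \<kappa> of each, which is more than \<open>U - K\<close> can hold.\<close>

lemma null_if_complement_thick:
  fixes A :: "real set"
  assumes A: "A \<in> sets borel" and \<kappa>: "\<kappa> > 0"
    and thick: "\<And>s t. 0 \<le> s \<Longrightarrow> s \<le> t \<Longrightarrow> t \<le> 1 \<Longrightarrow> measure lborel (A \<inter> {s..<t}) \<ge> \<kappa> * (t - s)"
  shows "emeasure lborel ({0..<1} - A) = 0"
proof (rule ccontr)
  assume pos: "emeasure lborel ({0..<1} - A) \<noteq> 0"
  \<comment> \<open>Inner regularity is applied to a finite measure, so Lebesgue measure is cut down
    to \<open>{0..<1}\<close>.\<close>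
  define M where "M = density lborel (indicator {0..<1::real})"
  have M: "emeasure M X = emeasure lborel ({0..<1} \<inter> X)" if "X \<in> sets borel" for X
    using that by (auto simp: M_def emeasure_density indicator_inter_arith[symmetric])
  have sM: "sets M = sets borel" by (simp add: M_def)
  have "finite_measure M" using M[of UNIV] sM by (intro finite_measureI) (simp add: M_def)
  moreover have "emeasure M ({0..<1} - A) > 0"
    using pos A M[of "{0..<1} - A"] by (simp add: Int_absorb1 zero_less_iff_neq_zero)
  ultimately obtain K where K: "K \<subseteq> {0..<1} - A" "compact K" "emeasure M K > 0"
    using exists_compact_positive[OF sM, of "{0..<1} - A"] A by auto
  have Kb: "K \<in> sets borel" using K(2) by (simp add: borel_compact)
  have eK: "emeasure lborel K = ennreal (measure lborel K)"
    using K(2) emeasure_compact_finite[of K] by (simp add: emeasure_eq_ennreal_measure less_top)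
  have "{0..<1} \<inter> K = K" using K(1) by auto
  then have mK: "measure lborel K > 0" using K(3) M[OF Kb] eK by simp
  \<comment> \<open>Half of what \<open>A\<close> must occupy in the cells covering
    \<open>K\<close>.\<close>
  define e where "e = \<kappa> * measure lborel K / 2"
  have e: "e > 0" using mK \<kappa> by (simp add: e_def)
  obtain U where U: "open U" "K \<subseteq> U" "emeasure lborel (U - K) \<le> e"
    using outer_regular_lborel_le[OF Kb e] by blast
  obtain \<delta> where \<delta>: "\<delta> > 0" "(\<Union>x\<in>K. ball x \<delta>) \<subseteq> U"
    using compact_subset_open_imp_ball_epsilon_subset[OF K(2) U(1,2)] by blast
  \<comment> \<open>Cells shorter than \<delta> that meet \<open>K\<close> cannot leave
    \<open>U\<close>.\<close>
  obtain N :: nat where N: "N > 0" "1 / real N < \<delta>"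
    using nat_approx_posE[OF \<delta>(1)] by (metis zero_less_Suc)
  define cell where "cell i = {real i / N..<(real i + 1) / N}" for i
  define I where "I = {i. i < N \<and> cell i \<inter> K \<noteq> {}}"
  define W where "W = (\<Union>i\<in>I. cell i)"
  have finI: "finite I" by (simp add: I_def)
  have disj: "disjoint_family_on (\<lambda>i. X \<inter> cell i) I" for X
    unfolding disjoint_family_on_def
  proof (intro ballI impI)
    fix i j :: nat assume "i \<noteq> j"
    then have "real i + 1 \<le> real j \<or> real j + 1 \<le> real i" by linarith
    then have "(real i + 1) / N \<le> real j / N \<or> (real j + 1) / N \<le> real i / N"
      by (auto intro: divide_right_mono)
    then show "(X \<inter> cell i) \<inter> (X \<inter> cell j) = {}" by (auto simp: cell_def)
  qed
  have cell_U: "cell i \<subseteq> U" if i: "i \<in> I" for i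
  proof
    fix y assume y: "y \<in> cell i"
    obtain x where x: "x \<in> cell i" "x \<in> K" using i by (auto simp: I_def)
    have "dist x y < \<delta>" using x y N(2) by (auto simp: cell_def dist_real_def add_divide_distrib)
    then have "y \<in> ball x \<delta>" by simp
    then show "y \<in> U" using x(2) \<delta>(2) by blast
  qed
  have K_W: "K \<subseteq> W"
  proof
    fix x assume x: "x \<in> K"
    then have x01: "0 \<le> x" "x < 1" using K(1) by auto
    define i where "i = nat \<lfloor>real N * x\<rfloor>"
    have "real i \<le> real N * x" "real N * x < real i + 1" using x01 by (auto simp: i_def)
    then have "x \<in> cell i" using N(1) by (auto simp: cell_def field_simps)
    moreover have "i < N"
    proof -
      have "real i < real N" using \<open>real i \<le> real N * x\<close> x01 N(1)
        by (metis le_less_trans mult_less_cancel_left_pos mult.right_neutral of_nat_0_less_iff)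
      then show ?thesis by simp
    qed
    ultimately show "x \<in> W" using x by (auto simp: W_def I_def)
  qed
  have fin: "emeasure lborel (X \<inter> cell i) \<noteq> \<infinity>" if "X \<in> sets borel" for X i
  proof -
    have "emeasure lborel (X \<inter> cell i) \<le> emeasure lborel (cell i)"
      using that by (intro emeasure_mono) (auto simp: cell_def)
    also have "\<dots> < \<infinity>" by (simp add: cell_def divide_right_mono)
    finally show ?thesis by simp
  qed
  have cell_thick: "\<kappa> * measure lborel (UNIV \<inter> cell i) \<le> measure lborel (A \<inter> cell i)" if "i \<in> I" for i
  proof -
    have "i < N" using that by (simp add: I_def)
    then have "real i + 1 \<le> real N" by linarith
    then have "(real i + 1) / N \<le> 1" using N(1) by simp
    moreover have "real i / N \<le> (real i + 1) / N" by (simp add: divide_right_mono)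
    ultimately show ?thesis unfolding cell_def using thick[of "real i / N" "(real i + 1) / N"] by simp
  qed
  have sum: "measure lborel (X \<inter> W) = (\<Sum>i\<in>I. measure lborel (X \<inter> cell i))" if "X \<in> sets borel" for X
  proof -
    have "X \<inter> W = (\<Union>i\<in>I. X \<inter> cell i)" by (auto simp: W_def)
    moreover have "(\<lambda>i. X \<inter> cell i) ` I \<subseteq> sets lborel" using that by (auto simp: cell_def)
    ultimately show ?thesis using measure_finite_Union[OF finI _ disj[of X], of lborel] fin[OF that] by simp
  qed
  have finW: "emeasure lborel (X \<inter> W) \<noteq> \<infinity>" if "X \<in> sets borel" for X
  proof -
    have "X \<inter> W = (\<Union>i\<in>I. X \<inter> cell i)" by (auto simp: W_def)
    moreover have "(\<lambda>i. X \<inter> cell i) ` I \<subseteq> sets lborel" using that by (auto simp: cell_def)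
    ultimately have "emeasure lborel (X \<inter> W) \<le> (\<Sum>i\<in>I. emeasure lborel (X \<inter> cell i))"
      using emeasure_subadditive_finite[OF finI, of "\<lambda>i. X \<inter> cell i" lborel] by simp
    also have "\<dots> < \<infinity>" using fin[OF that] finI by (simp add: less_top)
    finally show ?thesis by simp
  qed
  have Wb: "W \<in> sets borel" by (auto simp: W_def cell_def I_def)
  have "\<kappa> * measure lborel K \<le> \<kappa> * measure lborel (UNIV \<inter> W)"
    using K_W Kb Wb finW[of UNIV] \<kappa> by (intro mult_left_mono measure_mono_fmeasurable)
      (auto simp: fmeasurable_def less_top)
  also have "\<dots> = (\<Sum>i\<in>I. \<kappa> * measure lborel (UNIV \<inter> cell i))" 
    by (subst sum) (simp_all add: sum_distrib_left)
  also have "\<dots> \<le> measure lborel (A \<inter> W)" using cell_thick sum[OF A] by (auto intro: sum_mono)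
  finally have 1: "\<kappa> * measure lborel K \<le> measure lborel (A \<inter> W)" .
  have "A \<inter> W \<subseteq> U - K" using K(1) cell_U by (auto simp: W_def)
  then have "emeasure lborel (A \<inter> W) \<le> emeasure lborel (U - K)"
    using U(1) Kb by (intro emeasure_mono) auto
  also have "\<dots> \<le> ennreal e" by (rule U(3))
  finally have "measure lborel (A \<inter> W) \<le> e" using e by (simp add: measure_def enn2real_leI)
  then show False using 1 e by (simp add: e_def)
qed

text \<open>\<open>G 1\<close> decides the alternative: if it is positive, the lower bound on
  increments makes \<open>A\<close> thick with proportion \<open>G 1 / \<beta>\<close>, so the
  complement is null.\<close>

theorem beta_transformation_ergodic_lborel:
  fixes \<beta> :: real
  assumes "\<beta> > 1" "A \<in> sets borel" "\<And>x. x \<in> {0..1} \<Longrightarrow> x \<in> A \<longleftrightarrow> frac (\<beta> * x) \<in> A"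
  shows "emeasure lborel ({0..1} \<inter> A) = 0 \<or> emeasure lborel ({0..1} - A) = 0"
proof -
  interpret beta_invariant_set \<beta> A by standard (use assms in auto)
  \<comment> \<open>The estimates live on \<open>{0..<1}\<close>; the endpoint 1 is restored as a
    null set.\<close>
  have null1: "emeasure lborel ({1::real} \<inter> X) = 0" for X
    by (rule emeasure_lborel_countable) auto
  have split: "emeasure lborel ({0..1} \<inter> X) \<le> emeasure lborel ({0..<1} \<inter> X)" if "X \<in> sets borel" for X :: "real set"
  proof -
    have "{0..1::real} = {0..<1} \<union> {1}" by auto
    then have "{0..1} \<inter> X = ({0..<1} \<inter> X) \<union> ({1} \<inter> X)" by auto
    then show ?thesis
      using emeasure_subadditive[of "{0..<1} \<inter> X" lborel "{1} \<inter> X"] that null1 by simp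
  qed
  show ?thesis
  proof (cases "G 1 = 0")
    case True
    have "emeasure lborel ({0..<1} \<inter> A) = 0"
      using True G_fin[of 0 1] by (simp add: G_def emeasure_eq_ennreal_measure less_top Int_commute)
    then show ?thesis using split[of A] assms(2) by simp
  next
    case False
    then have pos: "G 1 / \<beta> > 0" using G_mono[of 0 1] assms(1) by (simp add: G_0)
    have "emeasure lborel ({0..<1} - A) = 0"
      using G_lower G_diff by (intro null_if_complement_thick[OF assms(2) pos]) fastforce
    then show ?thesis using split[of "- A"] assms(2) by (simp add: Diff_eq)
  qed
qed

section \<open>Uniqueness of absolutely continuous invariant measures\<close>

lemma density_mono_on:
  assumes [measurable]: "f \<in> borel_measurable M" "g \<in> borel_measurable M" "X \<in> sets M"
    and le: "\<And>x. x \<in> X \<Longrightarrow> f x \<le> g x"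
  shows "emeasure (density M f) X \<le> emeasure (density M g) X"
  using le by (auto simp: emeasure_density indicator_def intro!: nn_integral_mono)

lemma density_eq_imp_null:
  assumes [measurable]: "f \<in> borel_measurable M" "g \<in> borel_measurable M" "X \<in> sets M"
    and less: "\<And>x. x \<in> X \<Longrightarrow> f x < g x"
    and eq: "emeasure (density M f) X = emeasure (density M g) X"
    and fin: "emeasure (density M g) X \<noteq> \<infinity>"
  shows "emeasure M X = 0"
proof -
  have le: "f x * indicator X x \<le> g x * indicator X x" for x
    using less[of x] by (auto simp: indicator_def)
  have "(\<integral>\<^sup>+x. (g x * indicator X x - f x * indicator X x) \<partial>M) =
      (\<integral>\<^sup>+x. g x * indicator X x \<partial>M) - (\<integral>\<^sup>+x. f x * indicator X x \<partial>M)"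
    using eq fin le by (intro nn_integral_diff) (auto simp: emeasure_density)
  also have "\<dots> = 0" using eq fin by (simp add: emeasure_density)
  finally have "AE x in M. g x * indicator X x - f x * indicator X x = 0"
    by (subst (asm) nn_integral_0_iff_AE) auto
  then have "AE x in M. x \<notin> X"
  proof (rule AE_mp, intro AE_I2 impI)
    fix x assume *: "g x * indicator X x - f x * indicator X x = 0"
    show "x \<notin> X"
    proof
      assume "x \<in> X"
      then have "g x - f x = 0" "f x < g x" using * less by auto
      then show False by (metis diff_gr0_ennreal less_irrefl)
    qed
  qed
  then have "X \<in> null_sets M" using AE_iff_null_sets[OF assms(3)] by simp
  then show ?thesis by auto
qed

text \<open>The inequality for a set and for its complement, with equal total masses, leaves no
  room.\<close>

lemma prob_spaces_eqI_le:
  assumes "prob_space M" "prob_space N" and sets: "sets N = sets M"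
    and le: "\<And>X. X \<in> sets M \<Longrightarrow> emeasure M X \<le> emeasure N X"
  shows "M = N"
proof (rule measure_eqI)
  interpret M: prob_space M by fact
  interpret N: prob_space N by fact
  have sp: "space N = space M" using sets by (rule sets_eq_imp_space_eq)
  have le': "measure M X \<le> measure N X" if "X \<in> sets M" for X
    using le[OF that] by (simp add: M.emeasure_eq_measure N.emeasure_eq_measure)
  fix X assume X: "X \<in> sets M"
  have "measure N X = 1 - measure N (space M - X)"
    using N.prob_compl[of X] X sets sp by simp
  also have "\<dots> \<le> 1 - measure M (space M - X)" using le'[of "space M - X"] X by simp
  also have "\<dots> = measure M X" using M.prob_compl[of X] X by simp
  finally show "emeasure M X = emeasure N X"
    using le'[OF X] by (simp add: M.emeasure_eq_measure N.emeasure_eq_measure)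
qed (use sets in simp)

text \<open>Ergodicity speaks of strictly invariant sets, but comparing densities gives invariance
  only up to null sets. The limsup set repairs this: it is strictly invariant, and it agrees with
  \<open>A\<close> almost everywhere because the exceptional set has null preimages under all
  iterates.\<close>

lemma invariant_mod_null_limsup:
  assumes [measurable]: "R \<in> measurable M M" "A \<in> sets M"
    and inv: "\<And>X. X \<in> sets M \<Longrightarrow> emeasure N (R -` X \<inter> space M) = emeasure N X"
    and sets: "sets N = sets M"
    and A: "AE x in N. x \<in> A \<longleftrightarrow> R x \<in> A"
  shows "AE x in N. x \<in> A \<longleftrightarrow> (\<exists>\<^sub>\<infinity>n. (R ^^ n) x \<in> A)"
proof -
  have sp: "space N = space M" using sets by (rule sets_eq_imp_space_eq)
  have Rn [measurable]: "(R ^^ n) \<in> measurable M M" for n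
    by (induction n) (auto intro: measurable_comp[of _ M M] assms(1))
  have "AE x in N. (R ^^ n) x \<in> A \<longleftrightarrow> (R ^^ Suc n) x \<in> A" for n
  proof (induction n)
    case 0
    then show ?case using A by simp
  next
    case (Suc n)
    define Y where "Y = {x \<in> space M. \<not> ((R ^^ n) x \<in> A \<longleftrightarrow> (R ^^ Suc n) x \<in> A)}"
    have [measurable]: "Y \<in> sets M" unfolding Y_def by measurable
    have "emeasure N Y = 0"
      using Suc by (subst (asm) AE_iff_measurable[of Y]) (auto simp: Y_def sp sets)
    then have "emeasure N (R -` Y \<inter> space M) = 0" using inv by simp
    moreover have "R -` Y \<inter> space M = {x \<in> space N. \<not> ((R ^^ Suc n) x \<in> A \<longleftrightarrow> (R ^^ Suc (Suc n)) x \<in> A)}"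
      using measurable_space[OF assms(1)] by (auto simp: Y_def sp funpow_swap1)
    moreover have "R -` Y \<inter> space M \<in> sets N" using sets by (metis \<open>Y \<in> sets M\<close> assms(1) measurable_sets)
    ultimately show ?case by (subst AE_iff_measurable) auto
  qed
  then have "AE x in N. \<forall>n. (R ^^ n) x \<in> A \<longleftrightarrow> (R ^^ Suc n) x \<in> A" by (simp add: AE_all_countable)
  then show ?thesis
  proof (rule AE_mp, intro AE_I2 impI)
    fix x assume *: "\<forall>n. (R ^^ n) x \<in> A \<longleftrightarrow> (R ^^ Suc n) x \<in> A"
    have "(R ^^ n) x \<in> A \<longleftrightarrow> x \<in> A" for n
      by (induction n) (use * in auto)
    then show "x \<in> A \<longleftrightarrow> (\<exists>\<^sub>\<infinity>n. (R ^^ n) x \<in> A)" by (simp add: INFM_const)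
  qed
qed

text \<open>The set \<open>A\<close> where the density \<open>h1\<close> exceeds \<open>h2\<close>
  turns out to be invariant up to null sets. Ergodicity makes it negligible or conegligible, so one
  measure dominates the other and they coincide. The reference measure \<open>M\<close> itself is
  not assumed invariant.\<close>

theorem ac_invariant_measure_unique:
  assumes M: "sigma_finite_measure M" and R [measurable]: "R \<in> measurable M M"
    and erg: "\<And>A. A \<in> sets M \<Longrightarrow> R -` A \<inter> space M = A \<Longrightarrow> emeasure M A = 0 \<or> emeasure M (space M - A) = 0"
    and N1: "prob_space N1" "sets N1 = sets M" "absolutely_continuous M N1"
      "\<And>A. A \<in> sets M \<Longrightarrow> emeasure N1 (R -` A \<inter> space M) = emeasure N1 A"
    and N2: "prob_space N2" "sets N2 = sets M" "absolutely_continuous M N2"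
      "\<And>A. A \<in> sets M \<Longrightarrow> emeasure N2 (R -` A \<inter> space M) = emeasure N2 A"
  shows "N1 = N2"
proof -
  interpret M: sigma_finite_measure M by fact
  interpret N1: prob_space N1 by fact
  interpret N2: prob_space N2 by fact
  have sp: "space N1 = space M" "space N2 = space M" using N1(2) N2(2) by (auto dest: sets_eq_imp_space_eq)
  define h1 where "h1 = RN_deriv M N1"
  define h2 where "h2 = RN_deriv M N2"
  have [measurable]: "h1 \<in> borel_measurable M" "h2 \<in> borel_measurable M" by (auto simp: h1_def h2_def)
  have d1: "density M h1 = N1" unfolding h1_def using N1 by (intro M.density_RN_deriv) auto
  have d2: "density M h2 = N2" unfolding h2_def using N2 by (intro M.density_RN_deriv) auto
  define A where "A = {x \<in> space M. h2 x < h1 x}"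
  have A [measurable]: "A \<in> sets M" unfolding A_def by measurable
  define P where "P = R -` A \<inter> space M"
  have P [measurable]: "P \<in> sets M" unfolding P_def using A R by (rule measurable_sets[rotated])
  \<comment> \<open>\<open>A\<close> and its preimage \<open>P\<close> have equal mass, so the parts
    outside their intersection balance.\<close>
  have diff: "measure N (A - P) = measure N (P - A)"
    if "prob_space N" "sets N = sets M" "\<And>A. A \<in> sets M \<Longrightarrow> emeasure N (R -` A \<inter> space M) = emeasure N A" for N
  proof -
    interpret N: prob_space N by fact
    have "measure N P = measure N A" using that(3)[OF A] by (simp add: P_def measure_def)
    moreover have "measure N (A - P) = measure N A - measure N (A \<inter> P)"
      using A P that(2) by (intro N.finite_measure_Diff') auto
    moreover have "measure N (P - A) = measure N P - measure N (P \<inter> A)"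
      using A P that(2) by (intro N.finite_measure_Diff') auto
    ultimately show ?thesis by (simp add: Int_commute)
  qed
  have 1: "measure N2 X \<le> measure N1 X" if "X \<in> sets M" "X \<subseteq> A" for X
  proof -
    have "emeasure (density M h2) X \<le> emeasure (density M h1) X"
      using that by (intro density_mono_on) (auto simp: A_def less_imp_le)
    then show ?thesis by (simp add: d1 d2 N1.emeasure_eq_measure N2.emeasure_eq_measure)
  qed
  have 2: "measure N1 X \<le> measure N2 X" if "X \<in> sets M" "X \<inter> A = {}" for X
  proof -
    have "emeasure (density M h1) X \<le> emeasure (density M h2) X"
    proof (rule density_mono_on)
      fix x assume "x \<in> X"
      then have "x \<in> space M" "x \<notin> A" using that sets.sets_into_space by auto
      then show "h1 x \<le> h2 x" by (simp add: A_def not_less)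
    qed (use that in auto)
    then show ?thesis by (simp add: d1 d2 N1.emeasure_eq_measure N2.emeasure_eq_measure)
  qed
  \<comment> \<open>N1(A - P) = N1(P - A) \<le> N2(P - A) = N2(A - P) \<le> N1(A - P), so equality
    holds throughout. Since \<open>h2 < h1\<close> on \<open>A - P\<close>, this set must be
    null.\<close>
  have eq: "measure N2 (A - P) = measure N1 (A - P)"
    using 1[of "A - P"] 2[of "P - A"] diff[OF N1(1,2,4)] diff[OF N2(1,2,4)] by fastforce
  have null: "emeasure M (A - P) = 0"
  proof (rule density_eq_imp_null[of h2 _ h1])
    show "emeasure (density M h2) (A - P) = emeasure (density M h1) (A - P)"
      using eq by (simp add: d1 d2 N1.emeasure_eq_measure N2.emeasure_eq_measure)
  qed (auto simp: A_def d1)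
  have AE: "AE x in N. x \<in> A \<longleftrightarrow> R x \<in> A"
    if N: "prob_space N" "sets N = sets M" "absolutely_continuous M N"
      "\<And>A. A \<in> sets M \<Longrightarrow> emeasure N (R -` A \<inter> space M) = emeasure N A" for N
  proof -
    interpret N: prob_space N by fact
    have spN: "space N = space M" using N(2) by (rule sets_eq_imp_space_eq)
    have "A - P \<in> null_sets M" using null A P by (intro null_setsI) auto
    then have *: "A - P \<in> null_sets N" using N(3) by (auto simp: absolutely_continuous_def)
    then have "measure N (P - A) = 0" using diff[OF N(1,2,4)] by (simp add: measure_eq_0_null_sets)
    then have "P - A \<in> null_sets N" using A P N(2) by (auto simp: null_sets_def N.emeasure_eq_measure)
    with * have "(A - P) \<union> (P - A) \<in> null_sets N" by auto
    then show ?thesis by (rule AE_I') (auto simp: P_def spN)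
  qed
  define A' where "A' = {x \<in> space M. \<exists>\<^sub>\<infinity>n. (R ^^ n) x \<in> A}"
  have Rn [measurable]: "(R ^^ n) \<in> measurable M M" for n
    by (induction n) (auto intro: measurable_comp[of _ M M] R)
  have A' [measurable]: "A' \<in> sets M" unfolding A'_def INFM_nat by measurable
  have "R -` A' \<inter> space M = A'"
  proof -
    have "(\<exists>\<^sub>\<infinity>n. (R ^^ n) (R x) \<in> A) \<longleftrightarrow> (\<exists>\<^sub>\<infinity>n. (R ^^ n) x \<in> A)" for x
    proof -
      have "(\<exists>\<^sub>\<infinity>n. (R ^^ n) (R x) \<in> A) \<longleftrightarrow> (\<exists>\<^sub>\<infinity>n. (R ^^ Suc n) x \<in> A)" by (simp add: funpow_swap1)
      also have "\<dots> \<longleftrightarrow> (\<exists>\<^sub>\<infinity>n. (R ^^ n) x \<in> A)"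
        using eventually_sequentially_Suc[of "\<lambda>n. (R ^^ n) x \<notin> A"]
        by (simp add: frequently_def cofinite_eq_sequentially)
      finally show ?thesis .
    qed
    then show ?thesis using measurable_space[OF R] by (auto simp: A'_def)
  qed
  then consider "emeasure M A' = 0" | "emeasure M (space M - A') = 0" using erg[OF A'] by auto
  then show ?thesis
  proof cases
    \<comment> \<open>\<open>N1\<close> does not charge \<open>A\<close>, and off \<open>A\<close>
      it lies below \<open>N2\<close>.\<close>
    case 1
    have "A' \<in> null_sets M" using 1 A' by (intro null_setsI)
    then have "A' \<in> null_sets N1" using N1(3) by (auto simp: absolutely_continuous_def)
    then have "AE x in N1. x \<notin> A'" by (rule AE_not_in)
    moreover have "AE x in N1. x \<in> A \<longleftrightarrow> R x \<in> A" by (rule AE[OF N1(1-3)]) (rule N1(4))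
    then have "AE x in N1. x \<in> A \<longleftrightarrow> (\<exists>\<^sub>\<infinity>n. (R ^^ n) x \<in> A)"
      by (rule invariant_mod_null_limsup[OF R A _ N1(2), rotated]) (rule N1(4))
    ultimately have AEA: "AE x in N1. x \<notin> A"
      by eventually_elim (use sets.sets_into_space[OF A] in \<open>auto simp: A'_def\<close>)
    have "emeasure N1 X \<le> emeasure N2 X" if X: "X \<in> sets M" for X
    proof -
      have "emeasure N1 X = emeasure N1 (X - A)"
        using AEA X A N1(2) by (intro emeasure_eq_AE) auto
      also have "\<dots> \<le> emeasure N2 (X - A)"
        using 2[of "X - A"] X A by (auto simp: N1.emeasure_eq_measure N2.emeasure_eq_measure)
      also have "\<dots> \<le> emeasure N2 X" using X A N2(2) by (intro emeasure_mono) auto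
      finally show ?thesis .
    qed
    then show ?thesis using N1 N2 by (intro prob_spaces_eqI_le) auto
  next
    \<comment> \<open>\<open>N2\<close> is carried by \<open>A\<close>, where it lies below
      \<open>N1\<close>.\<close>
    case 2
    have "space M - A' \<in> null_sets M" using 2 A' by (intro null_setsI) auto
    then have "space M - A' \<in> null_sets N2" using N2(3) by (auto simp: absolutely_continuous_def)
    then have "AE x in N2. x \<notin> space M - A'" by (rule AE_not_in)
    moreover have "AE x in N2. x \<in> A \<longleftrightarrow> R x \<in> A" by (rule AE[OF N2(1-3)]) (rule N2(4))
    then have "AE x in N2. x \<in> A \<longleftrightarrow> (\<exists>\<^sub>\<infinity>n. (R ^^ n) x \<in> A)"
      by (rule invariant_mod_null_limsup[OF R A _ N2(2), rotated]) (rule N2(4))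
    ultimately have AEA: "AE x in N2. x \<in> A"
      using AE_space by eventually_elim (auto simp: A'_def sp)
    have "emeasure N2 X \<le> emeasure N1 X" if X: "X \<in> sets M" for X
    proof -
      have "emeasure N2 X = emeasure N2 (X \<inter> A)"
        using AEA X A N2(2) by (intro emeasure_eq_AE) auto
      also have "\<dots> \<le> emeasure N1 (X \<inter> A)"
        using 1[of "X \<inter> A"] X A by (auto simp: N1.emeasure_eq_measure N2.emeasure_eq_measure)
      also have "\<dots> \<le> emeasure N1 X" using X A N1(2) by (intro emeasure_mono) auto
      finally show ?thesis .
    qed
    then have "N2 = N1" using N1 N2 by (intro prob_spaces_eqI_le) auto
    then show ?thesis by simp
  qed
qed

section \<open>Weak limits of empirical measures\<close>

text \<open>Using \<open>Suc N\<close> points makes every index, 0 included, give a probability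
  measure.\<close>

definition empirical :: "(nat \<Rightarrow> real) \<Rightarrow> nat \<Rightarrow> real measure" where
  "empirical u N = distr (measure_pmf (pmf_of_set {..<Suc N})) borel u"

lemma real_distribution_empirical: "real_distribution (empirical u N)"
proof -
  interpret prob_space "empirical u N"
    unfolding empirical_def by (rule measure_pmf.prob_space_distr) simp
  show ?thesis by standard (simp add: empirical_def)
qed

lemma integral_empirical:
  fixes f :: "real \<Rightarrow> 'a::{banach, second_countable_topology}"
  assumes [measurable]: "f \<in> borel_measurable borel"
  shows "integral\<^sup>L (empirical u N) f = (\<Sum>n<Suc N. f (u n)) /\<^sub>R real (Suc N)"
proof -
  have "integral\<^sup>L (empirical u N) f = (\<integral>n. f (u n) \<partial>measure_pmf (pmf_of_set {..<Suc N}))"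
    unfolding empirical_def by (rule integral_distr) simp_all
  also have "\<dots> = (\<Sum>n<Suc N. pmf (pmf_of_set {..<Suc N}) n *\<^sub>R f (u n))"
    by (rule integral_measure_pmf) (auto simp: set_pmf_of_set lessThan_empty_iff)
  also have "\<dots> = (\<Sum>n<Suc N. f (u n) /\<^sub>R real (Suc N))"
    by (intro sum.cong refl) (simp add: pmf_of_set lessThan_empty_iff indicator_def inverse_eq_divide del: sum.lessThan_Suc)
  finally show ?thesis by (simp add: scaleR_sum_right del: sum.lessThan_Suc)
qed

lemma measure_empirical_eq_1:
  assumes [measurable]: "E \<in> sets borel" and "\<And>n. u n \<in> E"
  shows "measure (empirical u N) E = 1"
proof -
  have "u -` E = UNIV" using assms(2) by auto
  then show ?thesis by (simp add: empirical_def measure_distr)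
qed

lemma tight_empirical:
  assumes "\<And>n. u n \<in> {0..1}"
  shows "tight (empirical u)"
proof -
  \<comment> \<open>Tightness is phrased with left-open intervals; the left end -1 keeps 0
    inside.\<close>
  have "measure (empirical u n) {-1<..1} = 1" for n
    using assms by (intro measure_empirical_eq_1) (auto intro: less_le_trans[of "-1" 0])
  then have "\<forall>\<epsilon>>0. \<exists>a b::real. a < b \<and> (\<forall>n. 1 - \<epsilon> < measure (empirical u n) {a<..b})"
    by (intro allI impI exI[of _ "-1"] exI[of _ 1]) auto
  then show ?thesis by (simp add: tight_def real_distribution_empirical)
qed

lemma tendsto_if_subsubsequences:
  fixes a :: "nat \<Rightarrow> 'a::metric_space"
  assumes "\<And>s. strict_mono (s :: nat \<Rightarrow> nat) \<Longrightarrow> \<exists>r. strict_mono (r :: nat \<Rightarrow> nat) \<and> (\<lambda>n. a (s (r n))) \<longlonglongrightarrow> L"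
  shows "a \<longlonglongrightarrow> L"
proof (rule ccontr)
  assume "\<not> a \<longlonglongrightarrow> L"
  then obtain e where e: "e > 0" and inf: "\<forall>N. \<exists>n\<ge>N. \<not> dist (a n) L < e"
    unfolding lim_sequentially by blast
  then have "infinite {n. \<not> dist (a n) L < e}" by (simp add: infinite_nat_iff_unbounded_le)
  then obtain s :: "nat \<Rightarrow> nat" where s: "strict_mono s" "\<And>n. s n \<in> {n. \<not> dist (a n) L < e}"
    using infinite_enumerate by blast
  obtain r where "strict_mono (r :: nat \<Rightarrow> nat)" "(\<lambda>n. a (s (r n))) \<longlonglongrightarrow> L" using assms[OF s(1)] by blast
  then obtain n where "dist (a (s (r n))) L < e" using e unfolding lim_sequentially by blast
  then show False using s(2)[of "r n"] by simp
qed

lemma sum_reindex_bounded_multiplicity: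
  fixes F :: "nat \<Rightarrow> real" and g :: "nat \<Rightarrow> nat"
  assumes F: "\<And>n. F n \<ge> 0" and g: "\<And>k. k < N \<Longrightarrow> g k < N'"
    and mult: "\<And>n. finite {k. g k = n}" "\<And>n. card {k. g k = n} \<le> m"
  shows "(\<Sum>k<N. F (g k)) \<le> real m * (\<Sum>n<N'. F n)"
proof -
  have "(\<Sum>k<N. F (g k)) = (\<Sum>n\<in>g ` {..<N}. \<Sum>k\<in>{k\<in>{..<N}. g k = n}. F (g k))"
    by (rule sum.image_gen) simp
  also have "\<dots> \<le> (\<Sum>n\<in>g ` {..<N}. real m * F n)"
  proof (rule sum_mono)
    fix n
    have "card {k\<in>{..<N}. g k = n} \<le> card {k. g k = n}" using mult(1) by (intro card_mono) auto
    also have "\<dots> \<le> m" by (rule mult(2))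
    finally have "real (card {k\<in>{..<N}. g k = n}) * F n \<le> real m * F n"
      using F by (intro mult_right_mono) auto
    then show "(\<Sum>k\<in>{k\<in>{..<N}. g k = n}. F (g k)) \<le> real m * F n" by simp
  qed
  also have "\<dots> \<le> (\<Sum>n<N'. real m * F n)" using g F by (intro sum_mono2) auto
  finally show ?thesis by (simp add: sum_distrib_left)
qed

text \<open>The first \<open>N\<close> terms of \<open>u\<close> refer to terms of \<open>v\<close>
  of index below \<open>m * N\<close>, each at most \<open>m\<close> times; averaging over
  \<open>N\<close> instead of \<open>m * N\<close> terms costs another \<open>m\<close>, hence the
  constant \<open>m * m\<close>. The averages of \<open>v\<close> converge along all indices, in
  particular along those needed here.\<close>

lemma weak_limit_dominated:
  fixes u v :: "nat \<Rightarrow> real"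
  assumes dom: "affinely_dominated u v"
    and v: "\<forall>f. continuous_on {0..1} f \<longrightarrow> (\<lambda>N. (\<Sum>n<N. f (v n)) / real N) \<longlonglongrightarrow> integral\<^sup>L \<sigma> f"
    and s: "strict_mono s" and \<rho>: "real_distribution \<rho>" "weak_conv_m (\<lambda>n. empirical u (s n)) \<rho>"
  shows "\<exists>\<Phi> C. finite \<Phi> \<and> (\<forall>\<phi>\<in>\<Phi>. fst \<phi> \<noteq> 0) \<and>
    (\<forall>f :: real \<Rightarrow> real. (\<forall>x. isCont f x \<and> 0 \<le> f x \<and> f x \<le> 1) \<longrightarrow>
       integral\<^sup>L \<rho> f \<le> C * (\<Sum>\<phi>\<in>\<Phi>. \<integral>y. f (fst \<phi> * y + snd \<phi>) \<partial>\<sigma>))"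
proof -
  obtain \<Phi> g m where \<Phi>: "finite \<Phi>" "\<forall>\<phi>\<in>\<Phi>. fst \<phi> \<noteq> 0" and m: "m > 0" and g: "\<forall>k. g k \<le> m * k"
    and mult: "\<forall>n. finite {k. g k = n} \<and> card {k. g k = n} \<le> m"
    and u: "\<forall>k. \<exists>\<phi>\<in>\<Phi>. u k = fst \<phi> * v (g k) + snd \<phi>"
    using dom unfolding affinely_dominated_def by blast
  have main: "integral\<^sup>L \<rho> f \<le> (real m * real m) * (\<Sum>\<phi>\<in>\<Phi>. \<integral>y. f (fst \<phi> * y + snd \<phi>) \<partial>\<sigma>)"
    if cont: "\<And>x. isCont f x" and f0: "\<And>x. 0 \<le> f x" and f1: "\<And>x. f x \<le> 1" for f :: "real \<Rightarrow> real"
  proof -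
    have fc: "continuous_on UNIV f" using cont by (simp add: continuous_at_imp_continuous_on)
    have [measurable]: "f \<in> borel_measurable borel" using fc by (rule borel_measurable_continuous_onI)
    have lim1: "(\<lambda>n. integral\<^sup>L (empirical u (s n)) f) \<longlonglongrightarrow> integral\<^sup>L \<rho> f"
      using cont f0 f1
      by (intro weak_conv_imp_integral_bdd_continuous_conv[OF real_distribution_empirical \<rho>, where B = 1]) auto
    define avg where "avg \<phi> N = (\<Sum>n<N. f (fst \<phi> * v n + snd \<phi>)) / real N" for \<phi> N
    have lim_avg: "avg \<phi> \<longlonglongrightarrow> (\<integral>y. f (fst \<phi> * y + snd \<phi>) \<partial>\<sigma>)" for \<phi>
      unfolding avg_def
      by (rule v[rule_format]) (auto intro!: continuous_on_compose2[OF fc] continuous_intros)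
    have sub: "filterlim (\<lambda>n. m * Suc (s n)) at_top sequentially"
    proof (rule filterlim_subseq)
      show "strict_mono (\<lambda>n. m * Suc (s n))" using s m by (auto simp: strict_mono_def)
    qed
    have lim2: "(\<lambda>n. (real m * real m) * (\<Sum>\<phi>\<in>\<Phi>. avg \<phi> (m * Suc (s n)))) \<longlonglongrightarrow>
        (real m * real m) * (\<Sum>\<phi>\<in>\<Phi>. \<integral>y. f (fst \<phi> * y + snd \<phi>) \<partial>\<sigma>)"
      by (intro tendsto_mult_left tendsto_sum filterlim_compose[OF lim_avg sub])
    have le: "integral\<^sup>L (empirical u (s n)) f \<le> (real m * real m) * (\<Sum>\<phi>\<in>\<Phi>. avg \<phi> (m * Suc (s n)))" for n
    proof -
      define N where "N = Suc (s n)"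
      have N: "N > 0" by (simp add: N_def)
      have gN: "g k < m * N" if "k < N" for k
      proof -
        have "m * k < m * N" using that m by simp
        then show ?thesis using g by (meson le_less_trans)
      qed
      have "(\<Sum>k<N. f (u k)) \<le> (\<Sum>k<N. \<Sum>\<phi>\<in>\<Phi>. f (fst \<phi> * v (g k) + snd \<phi>))"
      proof (rule sum_mono)
        fix k
        obtain \<phi> where "\<phi> \<in> \<Phi>" "u k = fst \<phi> * v (g k) + snd \<phi>" using u by blast
        then show "f (u k) \<le> (\<Sum>\<phi>\<in>\<Phi>. f (fst \<phi> * v (g k) + snd \<phi>))"
          using member_le_sum[of \<phi> \<Phi> "\<lambda>\<phi>. f (fst \<phi> * v (g k) + snd \<phi>)"] \<Phi>(1) f0 by simp
      qed
      also have "\<dots> = (\<Sum>\<phi>\<in>\<Phi>. \<Sum>k<N. f (fst \<phi> * v (g k) + snd \<phi>))" by (rule sum.swap)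
      also have "\<dots> \<le> (\<Sum>\<phi>\<in>\<Phi>. real m * (\<Sum>n<m * N. f (fst \<phi> * v n + snd \<phi>)))"
        using f0 gN mult by (intro sum_mono sum_reindex_bounded_multiplicity) auto
      also have "\<dots> = (\<Sum>\<phi>\<in>\<Phi>. real m * (real (m * N) * avg \<phi> (m * N)))"
        using m N by (intro sum.cong refl) (simp add: avg_def)
      also have "\<dots> = real N * ((real m * real m) * (\<Sum>\<phi>\<in>\<Phi>. avg \<phi> (m * N)))"
        by (simp add: sum_distrib_left mult_ac)
      finally have "(\<Sum>k<N. f (u k)) / real N \<le> (real m * real m) * (\<Sum>\<phi>\<in>\<Phi>. avg \<phi> (m * N))"
        using N by (simp add: field_simps)
      moreover have "integral\<^sup>L (empirical u (s n)) f = (\<Sum>k<N. f (u k)) / real N"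
        unfolding N_def by (subst integral_empirical) (auto simp: divide_inverse mult.commute simp del: sum.lessThan_Suc)
      ultimately show ?thesis by (simp add: N_def)
    qed
    show ?thesis by (rule LIMSEQ_le[OF lim1 lim2]) (use le in auto)
  qed
  show ?thesis
    by (rule exI[of _ \<Phi>], rule exI[of _ "real m * real m"]) (use \<Phi> main in simp)
qed

text \<open>Domination holds for continuous test functions, which cannot single out a null set.
  Inner regularity reduces to a compact null set, whose indicator is a pointwise limit of continuous
  functions; its affine preimages are null because the slopes are nonzero.\<close>

lemma weak_limit_absolutely_continuous:
  fixes u v :: "nat \<Rightarrow> real"
  assumes dom: "affinely_dominated u v"
    and \<sigma>: "prob_space \<sigma>" "sets \<sigma> = sets lebesgue01" "absolutely_continuous lebesgue01 \<sigma>"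
    and v: "\<forall>f. continuous_on {0..1} f \<longrightarrow> (\<lambda>N. (\<Sum>n<N. f (v n)) / real N) \<longlonglongrightarrow> integral\<^sup>L \<sigma> f"
    and s: "strict_mono s" and \<rho>: "real_distribution \<rho>" "weak_conv_m (\<lambda>n. empirical u (s n)) \<rho>"
    and E: "E \<in> sets borel" "emeasure lborel E = 0"
  shows "emeasure \<rho> E = 0"
proof (rule ccontr)
  interpret \<rho>: real_distribution \<rho> by fact
  interpret \<sigma>: prob_space \<sigma> by fact
  assume "emeasure \<rho> E \<noteq> 0"
  then obtain K where K: "K \<subseteq> E" "compact K" "emeasure \<rho> K > 0"
    using exists_compact_positive[of \<rho> E] E(1) \<rho>.finite_measure_axioms
    by (auto simp: zero_less_iff_neq_zero)
  obtain \<Phi> :: "(real \<times> real) set" and C :: real where \<Phi>: "finite \<Phi>" "\<forall>\<phi>\<in>\<Phi>. fst \<phi> \<noteq> 0"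
    and le: "\<forall>f :: real \<Rightarrow> real. (\<forall>x. isCont f x \<and> 0 \<le> f x \<and> f x \<le> 1) \<longrightarrow>
       integral\<^sup>L \<rho> f \<le> C * (\<Sum>\<phi>\<in>\<Phi>. \<integral>y. f (fst \<phi> * y + snd \<phi>) \<partial>\<sigma>)"
    using weak_limit_dominated[OF dom v s \<rho>] by (elim exE conjE)
  have Kne: "K \<noteq> {}" using K(3) by auto
  have Kb [measurable]: "K \<in> sets borel" using K(2) by (simp add: borel_compact)
  have Kcl: "closed K" using K(2) by (rule compact_imp_closed)
  define f where "f j x = max 0 (1 - real j * infdist x K)" for j :: nat and x
  have f_cont: "isCont (f j) x" for j x
    unfolding f_def by (intro continuous_intros)
  have f01: "0 \<le> f j x" "f j x \<le> 1" for j x by (auto simp: f_def infdist_nonneg)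
  have f_meas [measurable]: "f j \<in> borel_measurable borel" for j
    using f_cont by (intro borel_measurable_continuous_onI continuous_at_imp_continuous_on) auto
  have f_K: "f j x = 1" if "x \<in> K" for j x using that by (simp add: f_def)
  have f_lim: "(\<lambda>j. f j x) \<longlonglongrightarrow> indicator K x" for x
  proof (cases "x \<in> K")
    case True
    then show ?thesis by (simp add: f_K)
  next
    case False
    then have d: "infdist x K > 0"
      using infdist_pos_not_in_closed[OF Kcl Kne False] by simp
    obtain J :: nat where J: "1 / infdist x K < real J" using reals_Archimedean2 by blast
    have "f j x = 0" if "j \<ge> J" for j
    proof -
      have "1 / infdist x K \<le> real j" using J that by (meson le_less_trans less_imp_le of_nat_le_iff order_trans)
      then have "1 \<le> real j * infdist x K" using d by (simp add: field_simps)
      then show ?thesis by (simp add: f_def)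
    qed
    then have "eventually (\<lambda>j. f j x = 0) sequentially" using eventually_sequentially by blast
    then show ?thesis using False by (simp add: tendsto_eventually)
  qed
  have sp\<sigma>: "space \<sigma> = {0..1}"
    using sets_eq_imp_space_eq[OF \<sigma>(2)] by (simp add: lebesgue01_def space_restrict_space)
  have id_meas: "(\<lambda>y. y) \<in> borel_measurable \<sigma>"
    using \<sigma>(2) by (subst measurable_cong_sets[of \<sigma> lebesgue01 borel borel])
      (auto simp: lebesgue01_def intro!: measurable_restrict_space1)
  have aff_meas: "(\<lambda>y. a * y + b) \<in> borel_measurable \<sigma>" for a b :: real
    using id_meas by measurable
  have null: "{y \<in> space \<sigma>. fst \<phi> * y + snd \<phi> \<in> K} \<in> null_sets \<sigma>" if "\<phi> \<in> \<Phi>" for \<phi>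
  proof -
    define Y where "Y = {y. fst \<phi> * y + snd \<phi> \<in> K}"
    have Yb: "Y \<in> sets borel"
    proof -
      have "(\<lambda>y. fst \<phi> * y + snd \<phi>) -` K \<inter> space borel \<in> sets borel" by measurable
      then show ?thesis by (simp add: Y_def vimage_def)
    qed
    have "emeasure lborel K \<le> emeasure lborel E" using K(1) E(1) by (intro emeasure_mono) auto
    then have "emeasure lborel K = 0" using E(2) by simp
    then have "emeasure lborel Y = 0"
      using emeasure_affine_preimage[of "fst \<phi>" K "snd \<phi>"] \<Phi>(2) Kb that by (simp add: Y_def)
    then have "emeasure lborel ({0..1} \<inter> Y) \<le> 0"
      using emeasure_mono[of "{0..1} \<inter> Y" Y lborel] Yb by simp
    then have "{0..1} \<inter> Y \<in> null_sets lebesgue01"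
      unfolding lebesgue01_def using Yb
      by (auto simp: null_sets_def sets_restrict_space emeasure_restrict_space)
    then have "{0..1} \<inter> Y \<in> null_sets \<sigma>" using \<sigma>(3) by (auto simp: absolutely_continuous_def)
    moreover have "{y \<in> space \<sigma>. fst \<phi> * y + snd \<phi> \<in> K} = {0..1} \<inter> Y" by (auto simp: sp\<sigma> Y_def)
    ultimately show ?thesis by simp
  qed
  have lim: "(\<lambda>j. \<integral>y. f j (fst \<phi> * y + snd \<phi>) \<partial>\<sigma>) \<longlonglongrightarrow> 0" if "\<phi> \<in> \<Phi>" for \<phi>
  proof -
    have "(\<lambda>j. \<integral>y. f j (fst \<phi> * y + snd \<phi>) \<partial>\<sigma>) \<longlonglongrightarrow> (\<integral>y. indicator K (fst \<phi> * y + snd \<phi>) \<partial>\<sigma>)"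
    proof (rule integral_dominated_convergence[where w = "\<lambda>_. 1"])
      show "(\<lambda>y. indicator K (fst \<phi> * y + snd \<phi>) :: real) \<in> borel_measurable \<sigma>"
        using aff_meas by measurable
      show "(\<lambda>y. f j (fst \<phi> * y + snd \<phi>)) \<in> borel_measurable \<sigma>" for j
        using aff_meas by measurable
      show "AE y in \<sigma>. norm (f j (fst \<phi> * y + snd \<phi>)) \<le> 1" for j using f01 by (intro AE_I2) auto
    qed (use f_lim in auto)
    also have "(\<integral>y. indicator K (fst \<phi> * y + snd \<phi>) \<partial>\<sigma>) = (0 :: real)"
    proof (rule integral_eq_zero_AE)
      show "AE y in \<sigma>. indicator K (fst \<phi> * y + snd \<phi>) = (0 :: real)"
        using AE_not_in[OF null[OF that]] by (auto simp: indicator_def)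
    qed
    finally show ?thesis .
  qed
  have "measure \<rho> K \<le> C * (\<Sum>\<phi>\<in>\<Phi>. \<integral>y. f j (fst \<phi> * y + snd \<phi>) \<partial>\<sigma>)" for j
  proof -
    have "measure \<rho> K = (\<integral>x. indicator K x \<partial>\<rho>)" by simp
    also have "\<dots> \<le> integral\<^sup>L \<rho> (f j)"
    proof (rule integral_mono)
      show "integrable \<rho> (f j)" using f01 by (intro \<rho>.integrable_const_bound[of _ 1]) auto
      show "integrable \<rho> (indicator K :: real \<Rightarrow> real)" by (simp add: \<rho>.emeasure_eq_measure)
    qed (auto simp: indicator_def f_K f01)
    also have "\<dots> \<le> C * (\<Sum>\<phi>\<in>\<Phi>. \<integral>y. f j (fst \<phi> * y + snd \<phi>) \<partial>\<sigma>)"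
      using f_cont f01 by (intro le[rule_format]) simp
    finally show ?thesis .
  qed
  moreover have "(\<lambda>j. C * (\<Sum>\<phi>\<in>\<Phi>. \<integral>y. f j (fst \<phi> * y + snd \<phi>) \<partial>\<sigma>)) \<longlonglongrightarrow> C * (\<Sum>\<phi>\<in>\<Phi>. 0)"
    using lim by (intro tendsto_mult_left tendsto_sum)
  ultimately have "measure \<rho> K \<le> C * (\<Sum>\<phi>\<in>\<Phi>. 0)" by (intro LIMSEQ_le_const) auto
  then show False using K(3) by (simp add: \<rho>.emeasure_eq_measure)
qed

text \<open>Weak convergence takes place on the whole line. The truncated distance to the unit
  interval is an admissible test function that vanishes along the orbit.\<close>

lemma weak_limit_supported:
  assumes u: "\<And>n. u n \<in> {0..1}"
    and \<rho>: "real_distribution \<rho>" "weak_conv_m (\<lambda>n. empirical u (s n)) \<rho>"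
  shows "AE x in \<rho>. x \<in> {0..1}"
proof -
  interpret \<rho>: real_distribution \<rho> by fact
  define f where "f x = min 1 (infdist x {0..1::real})" for x
  have f_cont: "isCont f x" for x unfolding f_def by (intro continuous_intros)
  have [measurable]: "f \<in> borel_measurable borel"
    using f_cont by (intro borel_measurable_continuous_onI continuous_at_imp_continuous_on) auto
  have f0: "f x \<ge> 0" for x by (simp add: f_def infdist_nonneg)
  have "(\<lambda>n. integral\<^sup>L (empirical u (s n)) f) \<longlonglongrightarrow> integral\<^sup>L \<rho> f"
    using f_cont f0
    by (intro weak_conv_imp_integral_bdd_continuous_conv[OF real_distribution_empirical \<rho>, where B = 1])
      (auto simp: f_def)
  moreover have "integral\<^sup>L (empirical u (s n)) f = 0" for n
    using u by (subst integral_empirical) (auto simp: f_def simp del: sum.lessThan_Suc)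
  ultimately have "integral\<^sup>L \<rho> f = 0" by (simp add: LIMSEQ_const_iff)
  moreover have "integrable \<rho> f"
    using f0 by (intro \<rho>.integrable_const_bound[of _ 1]) (auto simp: f_def)
  ultimately have "AE x in \<rho>. f x = 0" using f0 by (subst (asm) integral_nonneg_eq_0_iff_AE) auto
  then show ?thesis
  proof (rule AE_mp, intro AE_I2 impI)
    fix x assume "f x = 0"
    then have "infdist x {0..1} = 0" by (auto simp: f_def min_def split: if_splits)
    then show "x \<in> {0..1}" by (subst in_closed_iff_infdist_zero) auto
  qed
qed

text \<open>Composition with a discontinuous \<open>R\<close> leaves the continuous test functions,
  but almost everywhere continuity suffices for the limit. Complex exponentials are enough, since
  characteristic functions determine the measure.\<close>

lemma weak_limit_invariant:
  fixes R :: "real \<Rightarrow> real"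
  assumes R [measurable]: "R \<in> borel_measurable borel"
    and u: "\<And>n. u (Suc n) = R (u n)"
    and s: "strict_mono s"
    and \<rho>: "real_distribution \<rho>" "weak_conv_m (\<lambda>n. empirical u (s n)) \<rho>"
    and disc: "{x. \<not> isCont R x} \<subseteq> D" "D \<in> sets borel" "emeasure \<rho> D = 0"
  shows "distr \<rho> borel R = \<rho>"
proof (rule Levy_uniqueness)
  interpret \<rho>: real_distribution \<rho> by fact
  show "real_distribution (distr \<rho> borel R)" by (rule \<rho>.real_distribution_distr) simp
  show "real_distribution \<rho>" by fact
  show "char (distr \<rho> borel R) = char \<rho>"
  proof
    fix t :: real
    define f where "f x = iexp (t * x)" for x
    have f_eq: "f = (\<lambda>x. iexp (t * x))" by (simp add: f_def fun_eq_iff)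
    have f_cont: "isCont f x" for x unfolding f_eq by (intro continuous_intros)
    have f_meas [measurable]: "f \<in> borel_measurable borel"
      using f_cont by (intro borel_measurable_continuous_onI continuous_at_imp_continuous_on) auto
    have f1: "norm (f x) = 1" for x by (simp add: f_def)
    have lim1: "(\<lambda>n. integral\<^sup>L (empirical u (s n)) f) \<longlonglongrightarrow> integral\<^sup>L \<rho> f"
      using f_cont f1
      by (intro weak_conv_imp_integral_bdd_continuous_conv[OF real_distribution_empirical \<rho>, where B = 1]) auto
    have lim2: "(\<lambda>n. integral\<^sup>L (empirical u (s n)) (\<lambda>x. f (R x))) \<longlonglongrightarrow> integral\<^sup>L \<rho> (\<lambda>x. f (R x))"
    proof (rule weak_conv_imp_bdd_ae_continuous_conv[OF real_distribution_empirical \<rho>, where B = 1])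
      have "{x. \<not> isCont (\<lambda>x. f (R x)) x} \<subseteq> D"
      proof
        fix x assume "x \<in> {x. \<not> isCont (\<lambda>x. f (R x)) x}"
        then have "\<not> isCont R x" using isCont_o2[of x R f] f_cont by auto
        then show "x \<in> D" using disc(1) by auto
      qed
      then show "emeasure \<rho> {x. \<not> isCont (\<lambda>x. f (R x)) x} = 0"
        by (rule emeasure_eq_0[rotated 2]) (simp_all add: disc)
      show "norm (f (R x)) \<le> 1" for x by (simp add: f1)
    qed simp
    \<comment> \<open>The sums telescope to two boundary terms of modulus 1, and \<open>s n\<close>
      is at least \<open>n\<close>.\<close>
    have bound: "norm (integral\<^sup>L (empirical u (s n)) (\<lambda>x. f (R x)) - integral\<^sup>L (empirical u (s n)) f) \<le> 2 / real (Suc n)" for n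
    proof -
      have "integral\<^sup>L (empirical u (s n)) (\<lambda>x. f (R x)) - integral\<^sup>L (empirical u (s n)) f
          = ((\<Sum>k<Suc (s n). f (u (Suc k))) - (\<Sum>k<Suc (s n). f (u k))) /\<^sub>R real (Suc (s n))"
        by (subst (1 2) integral_empirical) (auto simp: u scaleR_diff_right simp del: sum.lessThan_Suc)
      also have "(\<Sum>k<Suc (s n). f (u (Suc k))) - (\<Sum>k<Suc (s n). f (u k)) = f (u (Suc (s n))) - f (u 0)"
        unfolding sum_subtractf[symmetric] by (rule sum_lessThan_telescope)
      also have "norm ((f (u (Suc (s n))) - f (u 0)) /\<^sub>R real (Suc (s n))) \<le> 2 / real (Suc (s n))"
        using norm_triangle_ineq4[of "f (u (Suc (s n)))" "f (u 0)"] f1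
        by (simp add: divide_inverse mult.commute mult_right_mono)
      also have "\<dots> \<le> 2 / real (Suc n)"
        using strict_mono_imp_increasing[OF s, of n] by (intro divide_left_mono) auto
      finally show ?thesis .
    qed
    have "(\<lambda>n. 2 / real (Suc n)) \<longlonglongrightarrow> 0"
      using LIMSEQ_Suc[OF lim_const_over_n[of 2]] by simp
    then have "(\<lambda>n. integral\<^sup>L (empirical u (s n)) (\<lambda>x. f (R x)) - integral\<^sup>L (empirical u (s n)) f) \<longlonglongrightarrow> 0"
      by (rule Lim_null_comparison[rotated]) (intro always_eventually allI bound)
    moreover have "(\<lambda>n. integral\<^sup>L (empirical u (s n)) (\<lambda>x. f (R x)) - integral\<^sup>L (empirical u (s n)) f)
        \<longlonglongrightarrow> integral\<^sup>L \<rho> (\<lambda>x. f (R x)) - integral\<^sup>L \<rho> f"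
      by (intro tendsto_diff lim1 lim2)
    ultimately have "integral\<^sup>L \<rho> (\<lambda>x. f (R x)) - integral\<^sup>L \<rho> f = 0" by (rule LIMSEQ_unique[symmetric])
    moreover have "char (distr \<rho> borel R) t = integral\<^sup>L \<rho> (\<lambda>x. f (R x))"
      unfolding char_def f_eq by (subst integral_distr) auto
    moreover have "char \<rho> t = integral\<^sup>L \<rho> f" by (simp only: char_def f_eq)
    ultimately show "char (distr \<rho> borel R) t = char \<rho> t" by simp
  qed
qed

section \<open>Generic points\<close>

lemma sets_lebesgue01: "sets lebesgue01 = sets (restrict_space borel {0..1})"
  unfolding lebesgue01_def by (rule sets_restrict_space_cong) simp

lemma in_sets_lebesgue01_iff: "A \<in> sets lebesgue01 \<longleftrightarrow> A \<in> sets borel \<and> A \<subseteq> {0..1}"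
  unfolding sets_lebesgue01 by (subst sets_restrict_space_iff) auto

lemma space_lebesgue01 [simp]: "space lebesgue01 = {0..1}"
  by (simp add: lebesgue01_def space_restrict_space)

lemma emeasure_lebesgue01: "A \<subseteq> {0..1} \<Longrightarrow> emeasure lebesgue01 A = emeasure lborel A"
  unfolding lebesgue01_def by (rule emeasure_restrict_space) auto

lemma sigma_finite_lebesgue01: "sigma_finite_measure lebesgue01"
proof -
  have "finite_measure lebesgue01" by (rule finite_measureI) (simp add: emeasure_lebesgue01)
  then show ?thesis by (simp add: finite_measure_def)
qed

text \<open>Serves both directions: \<open>R\<close> is the map for which genericity is wanted,
  \<open>v\<close> the orbit under the other map and \<sigma> its measure. By tightness every
  subsequence of empirical measures has a convergent subsequence, and each limit restricts to
  \<nu>.\<close>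

theorem generic_if_affinely_dominated:
  assumes R: "R \<in> measurable lebesgue01 lebesgue01"
    and erg: "\<And>A. A \<in> sets lebesgue01 \<Longrightarrow> R -` A \<inter> {0..1} = A \<Longrightarrow>
      emeasure lebesgue01 A = 0 \<or> emeasure lebesgue01 ({0..1} - A) = 0"
    and cont: "\<And>y. y \<in> {0<..<1} - D \<Longrightarrow> isCont R y" and D: "D \<in> sets borel" "emeasure lborel D = 0"
    and \<nu>: "prob_space \<nu>" "sets \<nu> = sets lebesgue01" "absolutely_continuous lebesgue01 \<nu>" "preserves R \<nu>"
    and x: "x \<in> {0..1}"
    and dom: "affinely_dominated (\<lambda>n. (R ^^ n) x) v"
    and \<sigma>: "prob_space \<sigma>" "sets \<sigma> = sets lebesgue01" "absolutely_continuous lebesgue01 \<sigma>"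
    and v: "\<forall>f. continuous_on {0..1} f \<longrightarrow> (\<lambda>N. (\<Sum>n<N. f (v n)) / real N) \<longlonglongrightarrow> integral\<^sup>L \<sigma> f"
  shows "generic R \<nu> x"
  unfolding generic_def
proof (intro allI impI)
  fix f :: "real \<Rightarrow> real" assume f: "continuous_on {0..1} f"
  define u where "u n = (R ^^ n) x" for n
  have dom_u: "affinely_dominated u v" using dom by (simp add: u_def[abs_def])
  have u01: "u n \<in> {0..1}" for n
    by (induction n) (use x measurable_space[OF R] in \<open>auto simp: u_def\<close>)
  \<comment> \<open>The extension by 0 lets weak convergence on the line be used. It may jump at 0
    and 1, so these join the exceptional set.\<close>
  define R' where "R' y = (if y \<in> {0..1} then R y else 0)" for y
  have "R \<in> measurable (restrict_space borel {0..1}) borel"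
  proof -
    have "R \<in> measurable lebesgue01 (restrict_space borel {0..1})"
      using R by (simp add: measurable_cong_sets[OF refl sets_lebesgue01])
    then have "R \<in> measurable lebesgue01 borel" by (simp add: measurable_restrict_space2_iff)
    then show ?thesis by (simp add: measurable_cong_sets[OF sets_lebesgue01 refl])
  qed
  then have R'_meas [measurable]: "R' \<in> borel_measurable borel"
    unfolding R'_def by (subst (asm) measurable_restrict_space_iff[where c = 0]) auto
  have u_Suc: "u (Suc n) = R' (u n)" for n using u01[of n] by (simp add: u_def R'_def)
  \<comment> \<open>\<open>f\<close> is continuous on the unit interval only; clamping the argument
    makes it bounded and continuous on the line.\<close>
  define F where "F y = f (max 0 (min 1 y))" for y
  have F_cont: "continuous_on UNIV F"
    unfolding F_def by (intro continuous_on_compose2[OF f] continuous_intros) auto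
  have F_meas [measurable]: "F \<in> borel_measurable borel" using F_cont by (rule borel_measurable_continuous_onI)
  have F_f: "F y = f y" if "y \<in> {0..1}" for y using that by (simp add: F_def)
  have "compact (f ` {0..1})" using f by (intro compact_continuous_image) auto
  then obtain B where B: "\<And>y. y \<in> {0..1} \<Longrightarrow> norm (f y) \<le> B"
    by (meson bounded_iff compact_imp_bounded image_eqI)
  have F_B: "norm (F y) \<le> B" for y unfolding F_def by (rule B) auto
  have lim: "(\<lambda>N. integral\<^sup>L (empirical u N) F) \<longlonglongrightarrow> integral\<^sup>L \<nu> f"
  proof (rule tendsto_if_subsubsequences)
    fix s :: "nat \<Rightarrow> nat" assume s: "strict_mono s"
    obtain r \<rho> where r: "strict_mono r" and \<rho>: "real_distribution \<rho>" "weak_conv_m (empirical u \<circ> s \<circ> r) \<rho>"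
      using tight_imp_convergent_subsubsequence[OF tight_empirical[of u, OF u01] s] by blast
    interpret \<rho>: real_distribution \<rho> by fact
    have sr: "strict_mono (\<lambda>n. s (r n))" using s r by (auto simp: strict_mono_def)
    have \<rho>_lim: "weak_conv_m (\<lambda>n. empirical u (s (r n))) \<rho>" using \<rho>(2) by (simp add: comp_def)
    have \<rho>_ac: "emeasure \<rho> E = 0" if "E \<in> sets borel" "emeasure lborel E = 0" for E
      by (rule weak_limit_absolutely_continuous[OF dom_u \<sigma> v sr \<rho>(1) \<rho>_lim that])
    have \<rho>_01: "AE y in \<rho>. y \<in> {0..1}"
      by (rule weak_limit_supported[OF u01 \<rho>(1) \<rho>_lim])
    have \<rho>_out: "emeasure \<rho> (- {0..1}) = 0"
      using \<rho>_01 by (subst (asm) AE_iff_measurable[of "- {0..1}"]) auto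
    have \<rho>_inv: "distr \<rho> borel R' = \<rho>"
    proof (rule weak_limit_invariant[OF R'_meas u_Suc sr \<rho>(1) \<rho>_lim])
      show "{y. \<not> isCont R' y} \<subseteq> (D \<union> {0, 1}) \<union> - {0..1}"
      proof
        fix y assume y: "y \<in> {y. \<not> isCont R' y}"
        show "y \<in> (D \<union> {0, 1}) \<union> - {0..1}"
        proof (rule ccontr)
          assume "y \<notin> (D \<union> {0, 1}) \<union> - {0..1}"
          then have y': "y \<in> {0<..<1} - D" by auto
          then have "eventually (\<lambda>z. z \<in> {0<..<1}) (nhds y)" by (intro eventually_nhds_in_open) auto
          then have "eventually (\<lambda>z. R' z = R z) (nhds y)" by eventually_elim (simp add: R'_def)
          then have "isCont R' y \<longleftrightarrow> isCont R y" by (rule isCont_cong)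
          then show False using y cont[OF y'] by simp
        qed
      qed
      have "emeasure lborel (D \<union> {0, 1}) = 0"
        using emeasure_subadditive[of D lborel "{0, 1}"] D emeasure_lborel_countable[of "{0, 1::real}"] by simp
      then have "emeasure \<rho> (D \<union> {0, 1}) = 0" using D by (intro \<rho>_ac) auto
      then show "emeasure \<rho> ((D \<union> {0, 1}) \<union> - {0..1}) = 0"
        using emeasure_subadditive[of "D \<union> {0, 1}" \<rho> "- {0..1}"] D \<rho>_out by simp
      show "(D \<union> {0, 1}) \<union> - {0..1} \<in> sets borel" using D by auto
    qed
    define N1 where "N1 = restrict_space \<rho> {0..1}"
    have N1: "emeasure N1 A = emeasure \<rho> A" if "A \<subseteq> {0..1}" for A
      unfolding N1_def using that by (intro emeasure_restrict_space) auto
    have "N1 = \<nu>"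
    proof (rule ac_invariant_measure_unique[OF sigma_finite_lebesgue01 R])
      show "A \<in> sets lebesgue01 \<Longrightarrow> R -` A \<inter> space lebesgue01 = A \<Longrightarrow>
          emeasure lebesgue01 A = 0 \<or> emeasure lebesgue01 (space lebesgue01 - A) = 0" for A
        using erg by simp
      show "prob_space N1"
      proof
        have "emeasure \<rho> {0..1} = emeasure \<rho> (space \<rho>)"
          using \<rho>_01 by (intro emeasure_eq_AE) auto
        then have "emeasure \<rho> {0..1} = 1" by (simp only: \<rho>.emeasure_space_1)
        then show "emeasure N1 (space N1) = 1" using N1[of "{0..1}"] by (simp add: N1_def space_restrict_space)
      qed
      show "sets N1 = sets lebesgue01"
        unfolding sets_lebesgue01 N1_def by (rule sets_restrict_space_cong) simp
      show "absolutely_continuous lebesgue01 N1"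
        unfolding absolutely_continuous_def null_sets_def \<open>sets N1 = sets lebesgue01\<close>
        using \<rho>_ac by (auto simp: N1 emeasure_lebesgue01 in_sets_lebesgue01_iff)
      show "emeasure N1 (R -` A \<inter> space lebesgue01) = emeasure N1 A" if "A \<in> sets lebesgue01" for A
      proof -
        have A: "A \<in> sets borel" "A \<subseteq> {0..1}" using that by (auto simp: in_sets_lebesgue01_iff)
        have "emeasure N1 A = emeasure (distr \<rho> borel R') A" using N1[OF A(2)] \<rho>_inv by simp
        also have "\<dots> = emeasure \<rho> (R' -` A)" using A by (subst emeasure_distr) auto
        also have "\<dots> = emeasure \<rho> (R -` A \<inter> {0..1})"
        proof (rule emeasure_eq_AE)
          show "R' -` A \<in> sets \<rho>" using measurable_sets[OF R'_meas A(1)] by simp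
          show "R -` A \<inter> {0..1} \<in> sets \<rho>"
            using measurable_sets[OF R that] by (simp add: in_sets_lebesgue01_iff)
          show "AE y in \<rho>. y \<in> R' -` A \<longleftrightarrow> y \<in> R -` A \<inter> {0..1}"
            using \<rho>_01 by eventually_elim (simp add: R'_def)
        qed
        also have "\<dots> = emeasure N1 (R -` A \<inter> {0..1})" by (rule N1[symmetric]) auto
        finally show ?thesis by simp
      qed
      have sp\<nu>: "space \<nu> = {0..1}" using sets_eq_imp_space_eq[OF \<nu>(2)] by simp
      show "emeasure \<nu> (R -` A \<inter> space lebesgue01) = emeasure \<nu> A" if "A \<in> sets lebesgue01" for A
        using \<nu>(2,4) that by (simp add: preserves_def sp\<nu>)
    qed (use \<nu> in auto)
    then have "integral\<^sup>L \<nu> f = (\<integral>y. indicator {0..1} y *\<^sub>R f y \<partial>\<rho>)"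
      unfolding N1_def by (subst integral_restrict_space[symmetric]) auto
    also have "\<dots> = (\<integral>y. indicator {0..1} y *\<^sub>R F y \<partial>\<rho>)"
      by (intro Bochner_Integration.integral_cong) (auto simp: indicator_def F_f)
    also have "\<dots> = integral\<^sup>L \<rho> F"
    proof (rule integral_cong_AE)
      show "AE y in \<rho>. indicator {0..1} y *\<^sub>R F y = F y" using \<rho>_01 by eventually_elim simp
    qed auto
    finally have "integral\<^sup>L \<nu> f = integral\<^sup>L \<rho> F" .
    moreover have "(\<lambda>n. integral\<^sup>L (empirical u (s (r n))) F) \<longlonglongrightarrow> integral\<^sup>L \<rho> F"
    proof (rule weak_conv_imp_integral_bdd_continuous_conv[OF real_distribution_empirical \<rho>(1) \<rho>_lim])
      show "isCont F y" for y using F_cont by (simp add: continuous_on_eq_continuous_at)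
    qed (rule F_B)
    ultimately show "\<exists>r. strict_mono r \<and> (\<lambda>n. integral\<^sup>L (empirical u (s (r n))) F) \<longlonglongrightarrow> integral\<^sup>L \<nu> f"
      using r by auto
  qed
  have "integral\<^sup>L (empirical u N) F = (\<Sum>n<Suc N. f ((R ^^ n) x)) / real (Suc N)" for N
    by (subst integral_empirical[OF F_meas])
      (simp add: F_f[OF u01] u_def[symmetric] divide_inverse mult.commute del: sum.lessThan_Suc of_nat_Suc)
  then have "(\<lambda>N. (\<Sum>n<Suc N. f ((R ^^ n) x)) / real (Suc N)) \<longlonglongrightarrow> integral\<^sup>L \<nu> f" using lim by simp
  then show "(\<lambda>N. (\<Sum>n<N. f ((R ^^ n) x)) / real N) \<longlonglongrightarrow> integral\<^sup>L \<nu> f"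
    by (rule LIMSEQ_imp_Suc)
qed

theorem theorem3p3:
  fixes \<beta> :: real and \<mu> \<nu> :: "real measure"
    and L :: nat and J :: "nat \<Rightarrow> real set"
    and \<epsilon> :: "nat \<Rightarrow> real" and m :: "nat \<Rightarrow> nat" and b :: "nat \<Rightarrow> real"
    and S :: "real \<Rightarrow> real" and c :: real
  defines "T \<equiv> (\<lambda>x. frac (\<beta> * x))"
  assumes pis: "pisot \<beta>"
    and mu_sets: "sets \<mu> = sets lebesgue01"
    and mu_prob: "prob_space \<mu>"
    and mu_ac: "absolutely_continuous lebesgue01 \<mu>"
    and mu_inv: "preserves T \<mu>"
    and J_int: "\<forall>i\<in>{1..L}. is_interval (J i) \<and> J i \<noteq> {}"
    and J_disj: "\<forall>i\<in>{1..L}. \<forall>j\<in>{1..L}. i \<noteq> j \<longrightarrow> J i \<inter> J j = {}"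
    and J_cover: "(\<Union>i\<in>{1..L}. J i) = {0..1}"
    and eps: "\<forall>i\<in>{1..L}. \<epsilon> i \<in> {-1, 1}"
    and m_pos: "\<forall>i\<in>{1..L}. m i > 0"
    and b_Q: "\<forall>i\<in>{1..L}. b i \<in> Qext \<beta>"
    and S_def: "\<forall>i\<in>{1..L}. \<forall>x\<in>J i. S x = \<epsilon> i * \<beta> ^ m i * x + b i"
    and S_range: "\<forall>x\<in>{0..1}. S x \<in> {0..1}"
    and nu_sets: "sets \<nu> = sets lebesgue01"
    and nu_prob: "prob_space \<nu>"
    and nu_ac: "absolutely_continuous lebesgue01 \<nu>"
    and nu_erg: "ergodic_for S \<nu>"
    and c_pos: "c > 0"
    and c_bounds: "\<forall>E. E \<in> sets borel \<and> E \<subseteq> {0..1} \<longrightarrow>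
        measure lborel E / c \<le> measure \<nu> E \<and> measure \<nu> E \<le> c * measure lborel E"
  shows "\<forall>x\<in>{0..1}. generic T \<mu> x \<longleftrightarrow> generic S \<nu> x"
proof
  fix x :: real assume x: "x \<in> {0..1}"
  interpret \<nu>: prob_space \<nu> by fact
  have \<beta>: "\<beta> > 1" using pis by (simp add: pisot_def)
  have nu_inv: "preserves S \<nu>" using nu_erg by (simp add: ergodic_for_def)
  have sp\<nu>: "space \<nu> = {0..1}" using sets_eq_imp_space_eq[OF nu_sets] by simp
  have T01: "T y \<in> {0..1}" for y by (simp add: T_def less_imp_le[OF frac_lt_1])
  define s where "s n = (S ^^ n) x" for n
  define t where "t n = (T ^^ n) x" for n
  have s01: "s n \<in> {0..1}" for n
    by (induction n) (use x S_range in \<open>auto simp: s_def\<close>)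
  have t01: "t n \<in> {0..1}" for n
    by (cases n) (use x T01 in \<open>auto simp: t_def\<close>)
  have "\<exists>i. i \<in> {1..L} \<and> s n \<in> J i" for n using s01[of n] J_cover by blast
  then obtain i where i: "\<And>n. i n \<in> {1..L}" "\<And>n. s n \<in> J (i n)" by metis
  \<comment> \<open>\<epsilon> is real valued, while the polynomial recursion needs integer
    signs.\<close>
  define e where "e n = (if \<epsilon> (i n) = 1 then 1 else - 1 :: int)" for n
  have e_eq: "of_int (e n) = \<epsilon> (i n)" for n
  proof -
    have "\<epsilon> (i n) \<in> {-1, 1}" using eps i(1) by blast
    then show ?thesis by (auto simp: e_def)
  qed
  have m_le: "m (i n) \<le> (\<Sum>j\<in>{1..L}. m j)" for n using i(1)[of n] by (intro member_le_sum) auto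
  have s_Suc: "s (Suc n) = of_int (e n) * \<beta> ^ m (i n) * s n + b (i n)" for n
    using S_def i[of n] by (simp add: s_def e_eq)
  have t_Suc: "t (Suc n) = \<beta> * t n - of_int \<lfloor>\<beta> * t n\<rfloor>" for n
    by (simp add: t_def T_def frac_def)
  have d: "\<lfloor>\<beta> * t n\<rfloor> \<ge> 0" "of_int \<lfloor>\<beta> * t n\<rfloor> \<le> \<beta>" for n
  proof -
    have "0 \<le> \<beta> * t n" "\<beta> * t n \<le> \<beta>" using t01[of n] \<beta> by (auto simp: mult_left_le)
    then show "\<lfloor>\<beta> * t n\<rfloor> \<ge> 0" "of_int \<lfloor>\<beta> * t n\<rfloor> \<le> \<beta>"
      using of_int_floor_le[of "\<beta> * t n"] by (auto simp del: of_int_floor_le)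
  qed
  have "finite (range (\<lambda>n. b (i n)))"
    by (rule finite_subset[of _ "b ` {1..L}"]) (use i(1) in auto)
  moreover have "range (\<lambda>n. b (i n)) \<subseteq> Qext \<beta>" using b_Q i(1) by auto
  ultimately have dom: "affinely_dominated s t" "affinely_dominated t s"
    using pisot_orbits_affinely_dominated[where s = s and t = t and e = e and k = "\<lambda>n. m (i n)"
        and b = "\<lambda>n. b (i n)" and d = "\<lambda>n. \<lfloor>\<beta> * t n\<rfloor>", OF pis _ s01 t01 s_Suc _ _ m_le _ _ t_Suc d] m_pos i(1)
    by (auto simp: s_def t_def e_def)

  have T_meas: "T \<in> measurable lebesgue01 lebesgue01"
    using mu_inv by (simp add: preserves_def measurable_cong_sets[OF mu_sets mu_sets])
  have S_meas: "S \<in> measurable lebesgue01 lebesgue01"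
    using nu_inv by (simp add: preserves_def measurable_cong_sets[OF nu_sets nu_sets])
  have T_erg: "emeasure lebesgue01 A = 0 \<or> emeasure lebesgue01 ({0..1} - A) = 0"
    if A: "A \<in> sets lebesgue01" "T -` A \<inter> {0..1} = A" for A
  proof -
    have "A \<in> sets borel" "A \<subseteq> {0..1}" using A(1) by (auto simp: in_sets_lebesgue01_iff)
    moreover have "y \<in> A \<longleftrightarrow> frac (\<beta> * y) \<in> A" if "y \<in> {0..1}" for y
      using A(2) that by (auto simp: T_def)
    ultimately show ?thesis
      using beta_transformation_ergodic_lborel[OF \<beta>, of A] by (simp add: emeasure_lebesgue01 Int_absorb1)
  qed
  \<comment> \<open>The lower bound in \<open>c_bounds\<close> makes \<nu>-null sets Lebesgue null
    and so transfers ergodicity to Lebesgue measure.\<close>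
  have S_erg: "emeasure lebesgue01 A = 0 \<or> emeasure lebesgue01 ({0..1} - A) = 0"
    if A: "A \<in> sets lebesgue01" "S -` A \<inter> {0..1} = A" for A
  proof -
    have Ab: "A \<in> sets borel" "A \<subseteq> {0..1}" using A(1) by (auto simp: in_sets_lebesgue01_iff)
    have null: "emeasure lebesgue01 E = 0" if "E \<in> sets borel" "E \<subseteq> {0..1}" "measure \<nu> E = 0" for E
    proof -
      have "measure lborel E / c \<le> 0" using c_bounds that by force
      then have "measure lborel E \<le> 0" using c_pos by (simp add: divide_le_0_iff)
      then have "measure lborel E = 0" by (simp add: measure_le_0_iff)
      moreover have "emeasure lborel E \<le> emeasure lborel {0..1::real}" using that by (intro emeasure_mono) auto
      then have "emeasure lborel E \<noteq> \<infinity>" by (auto simp: top_unique)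
      ultimately have "emeasure lborel E = 0" by (simp add: emeasure_eq_ennreal_measure)
      then show ?thesis using emeasure_lebesgue01[OF that(2)] by simp
    qed
    have "emeasure \<nu> A = 0 \<or> emeasure \<nu> A = 1"
      using nu_erg A by (simp add: ergodic_for_def nu_sets sp\<nu>)
    then have "measure \<nu> A = 0 \<or> measure \<nu> ({0..1} - A) = 0"
      using \<nu>.prob_compl[of A] A(1) by (auto simp: \<nu>.emeasure_eq_measure nu_sets sp\<nu>)
    then show ?thesis using null[of A] null[of "{0..1} - A"] Ab by auto
  qed
  \<comment> \<open>Off these points \<open>\<beta> * y\<close> is not an integer, so
    \<open>frac\<close> is continuous there.\<close>
  define D where "D = range (\<lambda>k::int. of_int k / \<beta>)"
  have "D \<in> null_sets lborel" unfolding D_def by (rule countable_imp_null_set_lborel) simp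
  then have D: "D \<in> sets borel" "emeasure lborel D = 0" by auto
  have T_cont: "isCont T y" if "y \<in> {0<..<1} - D" for y
  proof -
    have "\<beta> * y \<notin> \<int>"
    proof
      assume "\<beta> * y \<in> \<int>"
      then obtain k where "\<beta> * y = of_int k" by (auto elim: Ints_cases)
      then have "y = of_int k / \<beta>" using \<beta> by (simp add: field_simps)
      then show False using that by (auto simp: D_def)
    qed
    then have "isCont frac (\<beta> * y)" by (rule continuous_frac)
    moreover have "isCont (\<lambda>y. \<beta> * y) y" by (intro continuous_intros)
    ultimately show ?thesis unfolding T_def by (rule isCont_o2[rotated])
  qed
  \<comment> \<open>Away from the interval boundaries \<open>S\<close> is locally affine, and the
    frontier of a convex set is negligible.\<close>
  define D' where "D' = (\<Union>i\<in>{1..L}. frontier (J i))"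
  have "frontier (J j) \<in> null_sets lborel" if "j \<in> {1..L}" for j
  proof -
    have "negligible (frontier (J j))"
      using J_int that by (intro negligible_convex_frontier) (simp add: is_interval_convex)
    then show ?thesis by (simp add: negligible_iff_null_sets null_sets_completion_iff)
  qed
  then have "D' \<in> null_sets lborel" unfolding D'_def by (intro null_sets.finite_UN) auto
  then have D': "D' \<in> sets borel" "emeasure lborel D' = 0" by auto
  have S_cont: "isCont S y" if y: "y \<in> {0<..<1} - D'" for y
  proof -
    have "y \<in> {0..1}" using y by auto
    then obtain j where j: "j \<in> {1..L}" "y \<in> J j" using J_cover by blast
    have "y \<in> closure (J j)" using j(2) closure_subset by blast
    moreover have "y \<notin> frontier (J j)" using y j(1) unfolding D'_def by blast
    ultimately have "y \<in> interior (J j)" by (simp add: frontier_def)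
    then have "eventually (\<lambda>z. z \<in> interior (J j)) (nhds y)" by (intro eventually_nhds_in_open) auto
    then have "eventually (\<lambda>z. S z = \<epsilon> j * \<beta> ^ m j * z + b j) (nhds y)"
      by eventually_elim (use S_def j(1) interior_subset in blast)
    then have "isCont S y \<longleftrightarrow> isCont (\<lambda>z. \<epsilon> j * \<beta> ^ m j * z + b j) y" by (rule isCont_cong)
    then show ?thesis by simp
  qed
  show "generic T \<mu> x \<longleftrightarrow> generic S \<nu> x"
  proof
    assume "generic T \<mu> x"
    then have "\<forall>f. continuous_on {0..1} f \<longrightarrow> (\<lambda>N. (\<Sum>n<N. f (t n)) / real N) \<longlonglongrightarrow> integral\<^sup>L \<mu> f"
      by (simp add: generic_def t_def)
    moreover have "affinely_dominated (\<lambda>n. (S ^^ n) x) t" using dom(1) by (simp add: s_def[abs_def])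
    ultimately show "generic S \<nu> x"
      by (intro generic_if_affinely_dominated[OF S_meas S_erg S_cont D' nu_prob nu_sets nu_ac nu_inv x _
          mu_prob mu_sets mu_ac])
  next
    assume "generic S \<nu> x"
    then have "\<forall>f. continuous_on {0..1} f \<longrightarrow> (\<lambda>N. (\<Sum>n<N. f (s n)) / real N) \<longlonglongrightarrow> integral\<^sup>L \<nu> f"
      by (simp add: generic_def s_def)
    moreover have "affinely_dominated (\<lambda>n. (T ^^ n) x) s" using dom(2) by (simp add: t_def[abs_def])
    ultimately show "generic T \<mu> x"
      by (intro generic_if_affinely_dominated[OF T_meas T_erg T_cont D mu_prob mu_sets mu_ac mu_inv x _
          nu_prob nu_sets nu_ac])
  qed
qed

end
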